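(* Let $n\ge 1$, let $f$ be a non-constant meromorphic function in $\mathbb{C}$ and let $g$ be an entire function in $\mathbb{C}^n$. Put $h(z)=f(z_1+z_2+\cdots+z_n)$ for $z=(z_1,\ldots,z_n)\in\mathbb{C}^n$, and $G^g_h(z)=h(g(z),g(z),\ldots,g(z))$ (so $G^g_h(z)=f(ng(z))$). Suppose that for some $i\in\{1,2,\ldots,n\}$ and some constants $a,b,c\in\mathbb{C}$ with $a\neq 0$, $$\frac{\partial h(z)}{\partial z_i}=a\,G^g_h(z)+b\,h(z)+c \qquad (z\in\mathbb{C}^n).$$ Then: (i) if $f$ is transcendental, $g$ must be a linear polynomial in $\mathbb{C}^n$; (ii) if $f$ is a rational function, $g$ must be a polynomial in $\mathbb{C}^n$ of degree at most $2$. Furthermore, $\deg g=2$ if and only if $$f(z)=\beta+\frac{\alpha}{z-w_0},\qquad n\,g(z)=w_0-a\,(z_1+\cdots+z_n-w_0)^2,$$ and $b=a\beta+c=0$, where $\alpha\neq 0$, $\beta$, $w_0$ are complex numbers.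
   Context: A meromorphic function in $\mathbb{C}$ is transcendental if it is not rational. "Linear" for $g$ means $g$ is a polynomial in $z_1,\ldots,z_n$ of degree at most one. *)

theory Defs
  imports "HOL-Complex_Analysis.Complex_Analysis"
begin

definition entire_cn :: "(complex ^ 'n \<Rightarrow> complex) \<Rightarrow> bool" where
  "entire_cn g \<longleftrightarrow> (\<forall>z. \<exists>L. (g has_derivative L) (at z) \<and>
      (\<forall>w v. L (\<chi> j. w * v $ j) = w * L v))"

definition poly_cn_deg_le :: "nat \<Rightarrow> (complex ^ 'n \<Rightarrow> complex) \<Rightarrow> bool" where
  "poly_cn_deg_le d g \<longleftrightarrow> (\<exists>co :: ('n \<Rightarrow> nat) \<Rightarrow> complex. \<forall>z.
      g z = (\<Sum>e\<in>{e :: 'n \<Rightarrow> nat. (\<Sum>j\<in>UNIV. e j) \<le> d}. co e * (\<Prod>j\<in>UNIV. (z $ j) ^ e j)))"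

definition poly_cn :: "(complex ^ 'n \<Rightarrow> complex) \<Rightarrow> bool" where
  "poly_cn g \<longleftrightarrow> (\<exists>d. poly_cn_deg_le d g)"

definition poly_cn_deg_eq :: "nat \<Rightarrow> (complex ^ 'n \<Rightarrow> complex) \<Rightarrow> bool" where
  "poly_cn_deg_eq d g \<longleftrightarrow> poly_cn_deg_le d g \<and> (\<forall>k<d. \<not> poly_cn_deg_le k g)"

definition rational_fun :: "(complex \<Rightarrow> complex) \<Rightarrow> bool" where
  "rational_fun f \<longleftrightarrow> (\<exists>p q. q \<noteq> 0 \<and> (\<forall>z. poly q z \<noteq> 0 \<longrightarrow> f z = poly p z / poly q z))"

definition transcendental_fun :: "(complex \<Rightarrow> complex) \<Rightarrow> bool" where
  "transcendental_fun f \<longleftrightarrow> \<not> rational_fun f"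

end

theory Submission
  imports Defs
begin

text \<open>
  Restricted to a hyperplane where the sum \<open>s\<close> of the coordinates is a fixed regular point of
  \<open>f\<close>, the function \<open>n g\<close> takes values in the countable set of poles of \<open>f\<close> and points of one
  fibre of \<open>f\<close>, so it is constant there. Hence \<open>n g = \<phi> s\<close> with \<open>\<phi>\<close> entire, and
  \<open>f' = a (f \<circ> \<phi>) + b f + c\<close> in one variable. Suppose that \<open>\<phi>\<close> is not affine.

  Comparing poles, the set \<open>P\<close> of poles of \<open>f\<close> satisfies \<open>\<phi> z \<in> P \<longleftrightarrow> z \<in> P\<close>. If \<open>P\<close> had two
  points, the iterates of \<open>\<phi>\<close> would omit them off \<open>P\<close>; as \<open>\<phi> \<circ> \<phi>\<close> has a fixed point,
  Schottky's theorem would then bound all even iterates on a large circle. But by Schottky's theorem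
  again (in the form due to Bohr) the image of a large disc of radius \<open>r\<close> contains a circle around
  \<open>\<phi> 0\<close> of radius at least \<open>K r\<close>, for any \<open>K\<close>, which makes the iterates unbounded on large discs.
  So \<open>f\<close> has at most one pole \<open>w0\<close>, and comparing orders shows that it is simple:
  \<open>f = h + \<alpha> / (z - w0)\<close> with \<open>h\<close> entire. The covering property and the equation bound \<open>h\<close> on a
  disc of radius \<open>K r\<close> by a multiple, independent of \<open>K\<close>, of its bound on the disc of
  radius \<open>2 r\<close>, so that \<open>h\<close> is constant. The equation then determines \<open>\<phi>\<close>.
\<close>

section \<open>Growth of non-affine entire functions\<close>

text \<open>If the image of the disc contained no circle about \<open>\<phi> 0\<close> of radius at
  least \<open>\<kappa> * m\<close>, where \<open>m\<close> is the distance from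
  \<open>\<phi> z\<close> to \<open>\<phi> 0\<close>, it would miss a point on each of two such
  circles. Moving these points to 0 and 1, Schottky's theorem bounds the distance by a multiple of
  \<open>\<kappa> * m\<close>, which is absurd for small \<open>\<kappa>\<close>.\<close>

lemma entire_image_contains_sphere:
  "\<exists>\<kappa>::real>0. \<forall>\<phi> r z. \<phi> holomorphic_on UNIV \<longrightarrow> r > 0 \<longrightarrow> norm z \<le> r / 2 \<longrightarrow>
     (\<exists>\<rho> \<ge> \<kappa> * norm (\<phi> z - \<phi> 0). sphere (\<phi> 0) \<rho> \<subseteq> \<phi> ` cball 0 r)"
proof -
  \<comment> \<open>Schottky's bound at points of norm at most 1/2 for a function omitting 0 and 1
    whose value at 0 has norm at most 1.\<close>
  define S where "S = exp (pi * exp (pi * (2 + 2 * 1 + 12 * (1/2) / (1 - 1/2))))"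
  have S: "S > 0" by (simp add: S_def)
  \<comment> \<open>Chosen so that \<open>3 * S * \<kappa> + \<kappa> < 1\<close>, which contradicts
    the final estimate of \<open>m\<close>.\<close>
  define \<kappa> where "\<kappa> = 1 / (3 * S + 2)"
  have \<kappa>: "\<kappa> > 0" "\<kappa> * (3 * S + 2) = 1" using S by (auto simp: \<kappa>_def field_simps)
  show ?thesis
  proof (rule exI[of _ \<kappa>], intro conjI allI impI \<kappa>(1))
    fix \<phi> :: "complex \<Rightarrow> complex" and r :: real and z :: complex
    assume hol: "\<phi> holomorphic_on UNIV" and r: "r > 0" and z: "norm z \<le> r / 2"
    define m where "m = norm (\<phi> z - \<phi> 0)"
    show "\<exists>\<rho> \<ge> \<kappa> * norm (\<phi> z - \<phi> 0). sphere (\<phi> 0) \<rho> \<subseteq> \<phi> ` cball 0 r"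
    proof (cases "m = 0")
      case True
      have "sphere (\<phi> 0) 0 \<subseteq> \<phi> ` cball 0 r" using r by auto
      then show ?thesis using True by (auto simp: m_def)
    next
      case False
      then have m: "m > 0" by (simp add: m_def)
      show ?thesis
      proof (rule ccontr)
        assume neg: "\<not> ?thesis"
        have no: "\<not> sphere (\<phi> 0) \<rho> \<subseteq> \<phi> ` cball 0 r" if "\<rho> \<ge> \<kappa> * m" for \<rho>
          using neg that by (auto simp: m_def)
        have "\<kappa> * m > 0" using \<kappa> m by simp
        obtain w1 where w1: "dist (\<phi> 0) w1 = \<kappa> * m" "w1 \<notin> \<phi> ` cball 0 r"
          using no[of "\<kappa> * m"] by (meson mem_sphere order_refl subsetI)
        \<comment> \<open>Doubling the radius keeps \<open>w2\<close> at distance at least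
          \<open>\<kappa> * m\<close> from \<open>w1\<close>; this gives
          \<open>norm (\<psi> 0) \<le> 1\<close> below.\<close>
        obtain w2 where w2: "dist (\<phi> 0) w2 = 2 * (\<kappa> * m)" "w2 \<notin> \<phi> ` cball 0 r"
          using no[of "2 * (\<kappa> * m)"] \<open>\<kappa> * m > 0\<close>
          by (metis mem_sphere subsetI less_eq_real_def mult_2 add_increasing order_refl)
        have d_lo: "norm (w2 - w1) \<ge> \<kappa> * m"
          using w1 w2 dist_triangle[of "\<phi> 0" w2 w1] by (simp add: dist_norm norm_minus_commute)
        have d_hi: "norm (w2 - w1) \<le> 3 * (\<kappa> * m)"
          using w1 w2 dist_triangle3[of w1 w2 "\<phi> 0"] by (simp add: dist_norm norm_minus_commute)
        have ne: "w2 \<noteq> w1" using d_lo \<open>\<kappa> * m > 0\<close> by auto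
        define \<psi> where "\<psi> = (\<lambda>u. (\<phi> (of_real r * u) - w1) / (w2 - w1))"
        have holr: "(\<lambda>u. \<phi> (of_real r * u)) holomorphic_on cball 0 1"
          using holomorphic_on_compose_gen[of "\<lambda>u. of_real r * u" "cball 0 1" \<phi> UNIV] hol
          by (auto simp: o_def intro!: holomorphic_intros)
        have "norm (\<psi> (z / of_real r)) \<le> S" unfolding S_def
        proof (rule Schottky[where f = \<psi>])
          show "\<psi> holomorphic_on cball 0 1"
            unfolding \<psi>_def by (intro holomorphic_intros holr) (use ne in auto)
          show "norm (\<psi> 0) \<le> 1"
            using w1 d_lo \<open>\<kappa> * m > 0\<close> by (auto simp: \<psi>_def norm_divide dist_norm divide_le_eq)
          show "\<not> (\<psi> u = 0 \<or> \<psi> u = 1)" if "u \<in> cball 0 1" for u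
          proof -
            have "of_real r * u \<in> cball 0 r"
              using that r by (simp add: norm_mult mult_left_le)
            then have "\<phi> (of_real r * u) \<noteq> w1" "\<phi> (of_real r * u) \<noteq> w2" using w1 w2 by auto
            then show ?thesis using ne by (simp add: \<psi>_def)
          qed
          show "norm (z / of_real r) \<le> 1/2" using z r by (simp add: norm_divide field_simps)
        qed auto
        then have "norm (\<phi> z - w1) \<le> S * norm (w2 - w1)"
          using r ne by (simp add: \<psi>_def norm_divide divide_le_eq)
        also have "\<dots> \<le> S * (3 * (\<kappa> * m))" using d_hi S by simp
        finally have "m \<le> S * (3 * (\<kappa> * m)) + \<kappa> * m"
          using w1 dist_triangle[of "\<phi> z" "\<phi> 0" w1] by (simp add: m_def dist_norm norm_minus_commute)
        also have "\<dots> = (\<kappa> * (3 * S + 2)) * m - \<kappa> * m" by (simp add: algebra_simps)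
        also have "\<dots> < m" using \<kappa> \<open>\<kappa> * m > 0\<close> by simp
        finally show False by simp
      qed
    qed
  qed
qed

text \<open>Cauchy's estimate makes the second derivative vanish. A bound along some unbounded set
  of radii suffices, so for a non-affine function superlinear values occur at every large
  radius.\<close>

lemma entire_linear_growth_imp_affine:
  assumes hol: "\<phi> holomorphic_on UNIV"
    and bd: "\<And>r0. \<exists>r\<ge>r0. \<forall>z. norm z \<le> r \<longrightarrow> norm (\<phi> z) \<le> C * (r::real)"
  shows "\<exists>A B. \<forall>z. \<phi> z = A * z + B"
proof -
  have hold: "deriv \<phi> holomorphic_on UNIV" using hol by (intro holomorphic_intros) auto
  have d2: "deriv (deriv \<phi>) w = 0" for w
  proof -
    have "norm (deriv (deriv \<phi>) w) \<le> e" if "e > 0" for e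
    proof -
      \<comment> \<open>The circle of radius \<open>r/2\<close> about \<open>w\<close> must stay in
        the disc of radius \<open>r\<close>, and Cauchy's bound \<open>8 * C / r\<close> must not
        exceed \<open>e\<close>.\<close>
      define r0 where "r0 = max 1 (max (2 * norm w) (8 * C / e))"
      obtain r where r: "r \<ge> r0" and rb: "\<And>z. norm z \<le> r \<Longrightarrow> norm (\<phi> z) \<le> C * r" using bd by blast
      have rr: "r \<ge> 1" "2 * norm w \<le> r" "8 * C / e \<le> r" using r by (auto simp: r0_def)
      have "norm ((deriv ^^ 2) \<phi> w) \<le> fact 2 * (C * r) / (r/2)^2"
      proof (rule Cauchy_inequality)
        show "\<phi> holomorphic_on ball w (r/2)" using hol holomorphic_on_subset by blast
        show "continuous_on (cball w (r/2)) \<phi>"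
          using hol holomorphic_on_imp_continuous_on holomorphic_on_subset by blast
        show "norm (\<phi> x) \<le> C * r" if "norm (w - x) = r/2" for x
        proof (rule rb)
          show "norm x \<le> r" using that rr(2) norm_triangle_ineq3[of w x] by linarith
        qed
      qed (use rr in auto)
      also have "\<dots> = 8 * C / r" using rr by (simp add: power2_eq_square field_simps)
      also have "\<dots> \<le> e" using rr that by (simp add: field_simps)
      finally show ?thesis by (simp add: numeral_2_eq_2)
    qed
    then have "norm (deriv (deriv \<phi>) w) \<le> 0" by (rule field_le_epsilon) simp
    then show ?thesis by simp
  qed
  obtain A where A: "\<And>z. deriv \<phi> z = A"
  proof -
    have "(deriv \<phi> has_field_derivative 0) (at z)" for z
      using d2[of z] holomorphic_derivI[OF hold, of z] by simp
    then obtain c where "\<And>z. deriv \<phi> z = c"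
      using has_field_derivative_zero_constant[of UNIV "deriv \<phi>"] by auto
    then show ?thesis using that by blast
  qed
  have "((\<lambda>z. \<phi> z - A * z) has_field_derivative 0) (at z)" for z
    using holomorphic_derivI[OF hol, of z] A by (auto intro!: derivative_eq_intros)
  then obtain B where "\<And>z. \<phi> z - A * z = B"
    using has_field_derivative_zero_constant[of UNIV "\<lambda>z. \<phi> z - A * z"] by auto
  then have "\<forall>z. \<phi> z = A * z + B" by (metis add.commute diff_add_cancel)
  then show ?thesis by blast
qed

text \<open>The image of the disc of radius \<open>r\<close> contains a circle enclosing the disc of
  radius \<open>K * r\<close>, and the maximum modulus principle compares \<open>h w\<close> with a
  value of \<open>h\<close> on that circle. The threshold \<open>r0\<close> is independent of
  \<open>h\<close>, so that all iterates can be treated at once.\<close>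

lemma nonaffine_image_surrounds:
  fixes \<phi> :: "complex \<Rightarrow> complex" and K :: real
  assumes hol: "\<phi> holomorphic_on UNIV" and nonaff: "\<not> (\<exists>A B. \<forall>z. \<phi> z = A * z + B)"
    and K: "K \<ge> 0"
  obtains r0 where "r0 > 0"
    "\<And>r (h :: complex \<Rightarrow> complex) w. r \<ge> r0 \<Longrightarrow> h holomorphic_on UNIV \<Longrightarrow> norm w \<le> K * r \<Longrightarrow>
       \<exists>z. norm z \<le> r \<and> norm (h w) \<le> norm (h (\<phi> z)) \<and> K * r \<le> norm (\<phi> z)"
proof -
  obtain \<kappa> :: real where \<kappa>0: "\<kappa> > 0" 
    and \<kappa>1: "\<forall>\<phi> r z. \<phi> holomorphic_on UNIV \<longrightarrow> r > 0 \<longrightarrow> norm z \<le> r / 2 \<longrightarrow>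
       (\<exists>\<rho> \<ge> \<kappa> * norm (\<phi> z - \<phi> 0). sphere (\<phi> 0) \<rho> \<subseteq> \<phi> ` cball 0 r)"
    using entire_image_contains_sphere by (elim exE conjE)
  note \<kappa> = \<kappa>0 \<kappa>1[rule_format]
  \<comment> \<open>Makes \<open>\<kappa> * C * (r/2)\<close> at least \<open>(K + 1) * r\<close>;
    the extra \<open>r\<close> absorbs the shift of the centre from 0 to
    \<open>\<phi> 0\<close>.\<close>
  define C where "C = 2 * (K + 1) / \<kappa> + 1"
  define \<phi>' where "\<phi>' = (\<lambda>z. \<phi> z - \<phi> 0)"
  have hol': "\<phi>' holomorphic_on UNIV" unfolding \<phi>'_def by (intro holomorphic_intros hol)
  have "\<not> (\<forall>r0. \<exists>r\<ge>r0. \<forall>z. norm z \<le> r \<longrightarrow> norm (\<phi>' z) \<le> C * (r::real))"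
  proof
    assume "\<forall>r0. \<exists>r\<ge>r0. \<forall>z. norm z \<le> r \<longrightarrow> norm (\<phi>' z) \<le> C * (r::real)"
    then obtain A B where AB: "\<forall>z. \<phi>' z = A * z + B"
      using entire_linear_growth_imp_affine[OF hol'] by blast
    have "\<phi> z = A * z + (B + \<phi> 0)" for z
    proof -
      have "\<phi> z = \<phi>' z + \<phi> 0" by (simp add: \<phi>'_def)
      then show ?thesis unfolding AB[rule_format] by (simp only: add.assoc)
    qed
    with nonaff show False by blast
  qed
  then obtain r1 where "\<not> (\<exists>r\<ge>r1. \<forall>z. norm z \<le> r \<longrightarrow> norm (\<phi>' z) \<le> C * (r::real))"
    by blast
  then have r1: "\<exists>z. norm z \<le> r \<and> C * r < norm (\<phi>' z)" if "r \<ge> r1" for r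
    using that unfolding not_le[symmetric] by blast
  define r0 where "r0 = max 1 (max (2 * r1) (norm (\<phi> 0)))"
  show ?thesis
  proof (rule that[of r0])
    show "r0 > 0" by (simp add: r0_def)
    fix r :: real and h :: "complex \<Rightarrow> complex" and w :: complex
    assume r: "r \<ge> r0" and h: "h holomorphic_on UNIV" and w: "norm w \<le> K * r"
    have rr: "r \<ge> 1" "r/2 \<ge> r1" "norm (\<phi> 0) \<le> r" using r by (auto simp: r0_def)
    obtain z where z: "norm z \<le> r/2" "C * (r/2) < norm (\<phi>' z)" using r1[OF rr(2)] by blast
    obtain \<rho> where \<rho>: "\<rho> \<ge> \<kappa> * norm (\<phi>' z)" "sphere (\<phi> 0) \<rho> \<subseteq> \<phi> ` cball 0 r"
      using \<kappa>(2)[OF hol _ z(1)] rr by (auto simp: \<phi>'_def)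
    have "(K + 1) * r = \<kappa> * ((C - 1) * (r/2))" using \<kappa> by (simp add: C_def field_simps)
    also have "\<dots> \<le> \<kappa> * (C * (r/2))" using \<kappa>(1) rr by (intro mult_left_mono) auto
    also have "\<dots> \<le> \<kappa> * norm (\<phi>' z)" using z \<kappa>(1) by simp
    finally have \<rho>': "\<rho> \<ge> (K + 1) * r" using \<rho>(1) by linarith
    have "\<rho> \<ge> 0" using \<rho>' K rr by (meson add_nonneg_nonneg mult_nonneg_nonneg order_trans zero_le_one)
    have "norm (\<phi> 0 - w) \<le> \<rho>"
      using norm_triangle_ineq4[of "\<phi> 0" w] w rr(3) \<rho>' by (simp add: algebra_simps)
    have cont: "continuous_on A h" for A
      using h holomorphic_on_imp_continuous_on holomorphic_on_subset by blast
    have "continuous_on (sphere (\<phi> 0) \<rho>) (\<lambda>x. norm (h x))"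
      by (intro continuous_intros cont)
    moreover have "sphere (\<phi> 0) \<rho> \<noteq> {}" using \<open>\<rho> \<ge> 0\<close> by simp
    ultimately obtain v where v: "v \<in> sphere (\<phi> 0) \<rho>" 
        "\<And>x. x \<in> sphere (\<phi> 0) \<rho> \<Longrightarrow> norm (h x) \<le> norm (h v)"
      using continuous_attains_sup[OF compact_sphere] by (metis (no_types, lifting))
    have "norm (h w) \<le> norm (h v)"
    proof (rule maximum_modulus_frontier[of h "cball (\<phi> 0) \<rho>"])
      show "h holomorphic_on interior (cball (\<phi> 0) \<rho>)" using h holomorphic_on_subset by blast
      show "continuous_on (closure (cball (\<phi> 0) \<rho>)) h" by (rule cont)
      show "norm (h x) \<le> norm (h v)" if "x \<in> frontier (cball (\<phi> 0) \<rho>)" for x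
        using that v(2) by auto
    qed (use \<open>norm (\<phi> 0 - w) \<le> \<rho>\<close> in \<open>auto simp: dist_norm\<close>)
    moreover obtain z' where z': "norm z' \<le> r" "v = \<phi> z'" using v(1) \<rho>(2) by auto
    moreover have "K * r \<le> norm v"
    proof -
      have "norm (\<phi> 0 - v) = \<rho>" using v(1) by (simp add: dist_norm)
      then show ?thesis using norm_triangle_ineq4[of "\<phi> 0" v] rr(3) \<rho>' by (simp add: algebra_simps)
    qed
    ultimately show "\<exists>z. norm z \<le> r \<and> norm (h w) \<le> norm (h (\<phi> z)) \<and> K * r \<le> norm (\<phi> z)" by blast
  qed
qed

lemma holomorphic_on_UNIV_funpow:
  assumes "\<phi> holomorphic_on UNIV"
  shows "(\<phi> ^^ n) holomorphic_on UNIV"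
proof (induction n)
  case (Suc n)
  then show ?case
    using holomorphic_on_compose_gen[of "\<phi> ^^ n" UNIV \<phi> UNIV] assms by (simp add: comp_def)
qed (simp add: id_def holomorphic_on_ident)

text \<open>Induction on \<open>n\<close> for all radii at once: a point of norm at most
  \<open>2 * r\<close> where the \<open>n\<close>-th iterate is large is surrounded by the image of
  the disc of radius \<open>r\<close>, so the next iterate is at least as large somewhere on that
  disc.\<close>

lemma nonaffine_iterates_unbounded:
  fixes \<phi> :: "complex \<Rightarrow> complex"
  assumes hol: "\<phi> holomorphic_on UNIV" and nonaff: "\<not> (\<exists>A B. \<forall>z. \<phi> z = A * z + B)"
  obtains r0 where "r0 > 0" "\<And>r n. r \<ge> r0 \<Longrightarrow> \<exists>z. norm z \<le> r \<and> norm ((\<phi> ^^ n) z) \<ge> 2 ^ n * r"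
proof -
  obtain r0 where r0: "r0 > 0"
    "\<And>r (h :: complex \<Rightarrow> complex) w. r \<ge> r0 \<Longrightarrow> h holomorphic_on UNIV \<Longrightarrow> norm w \<le> 2 * r \<Longrightarrow>
       \<exists>z. norm z \<le> r \<and> norm (h w) \<le> norm (h (\<phi> z)) \<and> 2 * r \<le> norm (\<phi> z)"
    using nonaffine_image_surrounds[OF hol nonaff, of 2] by auto
  have "\<exists>z. norm z \<le> r \<and> norm ((\<phi> ^^ n) z) \<ge> 2 ^ n * r" if "r \<ge> r0" for r n
    using that
  proof (induction n arbitrary: r)
    case 0
    then show ?case using r0(1) by (intro exI[of _ "of_real r"]) auto
  next
    case (Suc n)
    obtain w where w: "norm w \<le> 2 * r" "2 ^ n * (2 * r) \<le> norm ((\<phi> ^^ n) w)"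
      using Suc.IH[of "2 * r"] Suc.prems r0(1) by auto
    obtain z where "norm z \<le> r" "norm ((\<phi> ^^ n) w) \<le> norm ((\<phi> ^^ n) (\<phi> z))"
      using r0(2)[OF Suc.prems holomorphic_on_UNIV_funpow[OF hol] w(1)] by blast
    then show ?case using w(2)
      by (intro exI[of _ z]) (auto simp: funpow_Suc_right simp del: funpow.simps)
  qed
  then show ?thesis using that r0(1) by blast
qed

section \<open>Completely invariant discrete sets\<close>

text \<open>The points \<open>u\<close> and \<open>v\<close> are less than \<open>2 * e\<close>
  apart, half the radius of the disc of radius \<open>4 * e\<close> about \<open>u\<close>, which
  lies in the large disc. After rescaling, Schottky's theorem applies with a bound that does not
  depend on \<open>h\<close>.\<close>

lemma Schottky_local:
  fixes h :: "complex \<Rightarrow> complex"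
  assumes hol: "h holomorphic_on ball z (6 * e)" and e: "e > 0"
    and omit: "\<And>x. x \<in> ball z (6 * e) \<Longrightarrow> h x \<noteq> p \<and> h x \<noteq> q"
    and pq: "p \<noteq> q" and u: "u \<in> ball z e" and v: "v \<in> ball z e" and r: "norm (h u) \<le> r"
  shows "norm (h v) \<le> norm (q - p) * exp (pi * exp (pi * (2 + 2 * ((r + norm p) / norm (q - p)) + 12 * (1/2) / (1 - 1/2)))) + norm p"
    (is "_ \<le> _ * ?S + _")
proof -
  define \<psi> where "\<psi> = (\<lambda>x. (h (u + of_real (4 * e) * x) - p) / (q - p))"
  have sub: "u + of_real (4 * e) * x \<in> ball z (6 * e)" if "x \<in> cball 0 1" for x
  proof -
    have "norm (of_real (4 * e) * x) \<le> 4 * e" using that e by (simp add: norm_mult)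
    moreover have "norm (z - u) < e" using u by (simp add: dist_norm)
    moreover have "norm (z - (u + of_real (4 * e) * x)) \<le> norm (z - u) + norm (of_real (4 * e) * x)"
      using norm_triangle_ineq4[of "z - u" "of_real (4 * e) * x"] by (simp add: diff_diff_eq)
    ultimately show ?thesis using e by (simp add: dist_norm)
  qed
  have holc: "(\<lambda>x. h (u + of_real (4 * e) * x)) holomorphic_on cball 0 1"
  proof -
    have "(h \<circ> (\<lambda>x. u + of_real (4 * e) * x)) holomorphic_on cball 0 1"
      by (rule holomorphic_on_compose_gen[OF _ hol]) (use sub in \<open>auto intro!: holomorphic_intros\<close>)
    then show ?thesis by (simp only: o_def)
  qed
  define x where "x = (v - u) / of_real (4 * e)"
  have ux: "u + of_real (4 * e) * x = v" using e by (simp add: x_def)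
  have "norm (v - u) < 2 * e"
    using u v dist_triangle3[of v u z] by (simp add: dist_norm)
  then have x: "norm x \<le> 1/2" using e by (simp add: x_def norm_divide norm_mult field_simps)
  have "norm (\<psi> x) \<le> ?S"
  proof (rule Schottky[where f = \<psi>])
    show "\<psi> holomorphic_on cball 0 1"
      unfolding \<psi>_def by (intro holomorphic_intros holc) (use pq in auto)
    have "norm (h u - p) \<le> r + norm p" using r norm_triangle_ineq4[of "h u" p] by linarith
    then show "norm (\<psi> 0) \<le> (r + norm p) / norm (q - p)"
      by (auto simp: \<psi>_def norm_divide intro!: divide_right_mono)
    show "\<not> (\<psi> y = 0 \<or> \<psi> y = 1)" if "y \<in> cball 0 1" for y
      using omit[OF sub[OF that]] pq by (simp add: \<psi>_def)
  qed (use x in auto)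
  then have "norm (h v - p) \<le> norm (q - p) * ?S"
    using pq unfolding \<psi>_def ux by (simp add: norm_divide divide_le_eq mult.commute)
  then show ?thesis using norm_triangle_ineq[of "h v - p" p] by simp
qed

text \<open>A chain argument in the style of Harnack's inequality: local Schottky bounds propagate
  through the connected set \<open>S\<close>, and compactness of \<open>K \<times> L\<close> makes
  them uniform in \<open>u\<close>, \<open>v\<close> and \<open>h\<close>.\<close>

lemma omitting_two_values_bounded:
  fixes S :: "complex set"
  assumes S: "open S" "connected S" and pq: "p \<noteq> q"
    and K: "compact K" "K \<subseteq> S" and L: "compact L" "L \<subseteq> S"
  shows "\<exists>B. \<forall>h u v. h holomorphic_on S \<longrightarrow> (\<forall>x\<in>S. h x \<noteq> p \<and> h x \<noteq> q) \<longrightarrow>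
           u \<in> K \<longrightarrow> v \<in> L \<longrightarrow> norm (h u) \<le> r \<longrightarrow> norm (h v) \<le> B"
proof -
  define F where "F = {h. h holomorphic_on S \<and> (\<forall>x\<in>S. h x \<noteq> p \<and> h x \<noteq> q)}"
  \<comment> \<open>\<open>C U V\<close> says that a bound at a single point of \<open>U\<close>
    controls all of \<open>V\<close>, uniformly over the family \<open>F\<close>. The relation
    \<open>R\<close> asks for both directions so as to be symmetric.\<close>
  define C where "C = (\<lambda>U V. \<forall>r. \<exists>B. \<forall>h\<in>F. \<forall>u\<in>U. \<forall>v\<in>V. norm (h u) \<le> r \<longrightarrow> norm (h v) \<le> B)"
  define R where "R = (\<lambda>a b. \<exists>U V. open U \<and> open V \<and> a \<in> U \<and> b \<in> V \<and> C U V \<and> C V U)"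
  \<comment> \<open>The bound passes through the common point \<open>x\<close>: what the first step
    yields at \<open>x\<close> is the input of the second.\<close>
  have C_trans: "C U W" if UV: "C U V" and VW: "C V' W" and x: "x \<in> V" "x \<in> V'" for U V V' W x
    unfolding C_def
  proof
    fix r
    obtain B where B: "\<forall>h\<in>F. \<forall>u\<in>U. \<forall>v\<in>V. norm (h u) \<le> r \<longrightarrow> norm (h v) \<le> B"
      using UV unfolding C_def by blast
    obtain B' where "\<forall>h\<in>F. \<forall>u\<in>V'. \<forall>v\<in>W. norm (h u) \<le> B \<longrightarrow> norm (h v) \<le> B'"
      using VW unfolding C_def by blast
    then show "\<exists>B. \<forall>h\<in>F. \<forall>u\<in>U. \<forall>v\<in>W. norm (h u) \<le> r \<longrightarrow> norm (h v) \<le> B"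
      using B x by blast
  qed
  have R: "R a b" if "a \<in> S" "b \<in> S" for a b
  proof (rule connected_equivalence_relation[OF S(2) that])
    show "R y x" if "R x y" for x y using that unfolding R_def by blast
    show "R x z" if "R x y" "R y z" for x y z
    proof -
      obtain U V where 1: "open U" "open V" "x \<in> U" "y \<in> V" "C U V" "C V U" 
        using \<open>R x y\<close> unfolding R_def by blast
      obtain V' W where 2: "open V'" "open W" "y \<in> V'" "z \<in> W" "C V' W" "C W V'" 
        using \<open>R y z\<close> unfolding R_def by blast
      have "C U W" "C W U" using C_trans 1 2 by blast+
      then show ?thesis unfolding R_def using 1 2 by blast
    qed
    show "\<exists>T. openin (top_of_set S) T \<and> z \<in> T \<and> (\<forall>x\<in>T. R z x)" if "z \<in> S" for z
    proof -
      obtain E where E: "E > 0" "ball z E \<subseteq> S" using S(1) \<open>z \<in> S\<close> open_contains_ball by blast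
      define e where "e = E / 6"
      have e: "e > 0" "ball z (6 * e) \<subseteq> S" "ball z e \<subseteq> S" using E by (auto simp: e_def)
      have "C (ball z e) (ball z e)"
        unfolding C_def
      proof (intro allI)
        fix r
        show "\<exists>B. \<forall>h\<in>F. \<forall>u\<in>ball z e. \<forall>v\<in>ball z e. norm (h u) \<le> r \<longrightarrow> norm (h v) \<le> B"
        proof (rule exI, intro ballI impI)
          fix h u v assume "h \<in> F" and uv: "u \<in> ball z e" "v \<in> ball z e" "norm (h u) \<le> r"
          show "norm (h v) \<le> norm (q - p) * exp (pi * exp (pi * (2 + 2 * ((r + norm p) / norm (q - p)) + 12 * (1/2) / (1 - 1/2)))) + norm p"
          proof (rule Schottky_local[where h = h and z = z and e = e and u = u, OF _ e(1) _ pq uv])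
            show "h holomorphic_on ball z (6 * e)"
              using \<open>h \<in> F\<close> e(2) holomorphic_on_subset by (auto simp: F_def)
            show "h x \<noteq> p \<and> h x \<noteq> q" if "x \<in> ball z (6 * e)" for x
              using \<open>h \<in> F\<close> e(2) that by (auto simp: F_def)
          qed
        qed
      qed
      then have "R z x" if "x \<in> ball z e" for x
        unfolding R_def using e(1) that by (intro exI[of _ "ball z e"]) auto
      then show ?thesis
        using e by (intro exI[of _ "ball z e"]) (auto simp: openin_open_eq S)
    qed
  qed
  have "\<exists>W B. open W \<and> x \<in> W \<and> (\<forall>h\<in>F. \<forall>u v. (u, v) \<in> W \<longrightarrow> norm (h u) \<le> r \<longrightarrow> norm (h v) \<le> B)"
    if xKL: "x \<in> K \<times> L" for x
  proof -
    obtain a b where x: "x = (a, b)" "a \<in> S" "b \<in> S" using xKL K L by blast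
    obtain U V where UV: "open U" "open V" "a \<in> U" "b \<in> V" "C U V"
      using R[OF x(2,3)] unfolding R_def by blast
    obtain B where B: "\<forall>h\<in>F. \<forall>u\<in>U. \<forall>v\<in>V. norm (h u) \<le> r \<longrightarrow> norm (h v) \<le> B"
      using UV(5) unfolding C_def by blast
    show ?thesis
      by (rule exI[of _ "U \<times> V"], rule exI[of _ B]) (use UV B x in \<open>auto intro: open_Times\<close>)
  qed
  then obtain W B where WB: "\<And>x. x \<in> K \<times> L \<Longrightarrow> open (W x) \<and> x \<in> W x \<and>
      (\<forall>h\<in>F. \<forall>u v. (u, v) \<in> W x \<longrightarrow> norm (h u) \<le> r \<longrightarrow> norm (h v) \<le> B x)"
    by metis
  obtain D where D: "D \<subseteq> K \<times> L" "finite D" "K \<times> L \<subseteq> (\<Union>x\<in>D. W x)"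
  proof (rule compactE_image[of "K \<times> L" "K \<times> L" W])
    show "compact (K \<times> L)" using K L by (intro compact_Times)
  qed (use WB in blast)+
  have "norm (h v) \<le> (\<Sum>x\<in>D. \<bar>B x\<bar>)" 
    if "h \<in> F" "u \<in> K" "v \<in> L" "norm (h u) \<le> r" for h u v
  proof -
    obtain x where x: "x \<in> D" "(u, v) \<in> W x" using D(3) \<open>u \<in> K\<close> \<open>v \<in> L\<close> by blast
    have "norm (h v) \<le> B x" using WB[of x] x D(1) that by blast
    also have "\<dots> \<le> \<bar>B x\<bar>" by simp
    also have "\<dots> \<le> (\<Sum>x\<in>D. \<bar>B x\<bar>)" using D(2) x(1) by (intro member_le_sum) auto
    finally show ?thesis .
  qed
  then show ?thesis unfolding F_def by (intro exI[of _ "\<Sum>x\<in>D. \<bar>B x\<bar>"]) simp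
qed

text \<open>Off \<open>P\<close> the iterates omit \<open>p\<close> and \<open>q\<close>. Even
  iterates share a fixed point, which provides values bounded independently of \<open>n\<close>; the
  bound spreads to a large disc and contradicts the growth of the iterates.\<close>

lemma completely_invariant_discrete_set_le_one:
  fixes \<phi> :: "complex \<Rightarrow> complex"
  assumes hol: "\<phi> holomorphic_on UNIV" and nonaff: "\<not> (\<exists>A B. \<forall>z. \<phi> z = A * z + B)"
    and disc: "P sparse_in UNIV" and inv: "\<And>z. \<phi> z \<in> P \<longleftrightarrow> z \<in> P"
    and p: "p \<in> P" and q: "q \<in> P"
  shows "p = q"
proof (rule ccontr)
  assume pq: "p \<noteq> q"
  have clP: "closed P" using disc sparse_in_UNIV_imp_closed by blast
  have cntP: "countable P" using sparse_imp_countable[of UNIV P] disc by simp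
  define S where "S = - P"
  have S: "open S" "connected S" using clP cntP
    by (auto simp: S_def path_connected_complement_countable path_connected_imp_connected)
  define \<Phi> where "\<Phi> = (\<lambda>n. \<phi> ^^ (2 * n))"
  have hol\<Phi>: "\<Phi> n holomorphic_on A" for n A
    using holomorphic_on_UNIV_funpow[OF hol] holomorphic_on_subset unfolding \<Phi>_def by blast
  have inv\<Phi>: "\<Phi> n z \<in> P \<longleftrightarrow> z \<in> P" for n z
  proof -
    have "(\<phi> ^^ m) z \<in> P \<longleftrightarrow> z \<in> P" for m by (induction m) (auto simp: inv)
    then show ?thesis by (simp add: \<Phi>_def)
  qed
  have omit: "\<Phi> n x \<noteq> p \<and> \<Phi> n x \<noteq> q" if "x \<in> S" for n x
    using inv\<Phi>[of n x] that p q by (auto simp: S_def)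
  \<comment> \<open>An entire function other than a translation has a second iterate with a fixed
    point.\<close>
  have "\<phi> \<noteq> (\<lambda>x. a + x)" for a
    using nonaff by (metis add.commute mult_1)
  then obtain z0 where z0: "\<phi> (\<phi> z0) = z0"
    using holomorphic_involution_point[OF hol] by metis
  have fix\<Phi>: "\<Phi> n z0 = z0" for n
    unfolding \<Phi>_def by (induction n) (auto simp: z0)
  \<comment> \<open>If the fixed point lies in \<open>P\<close>, move to a small circle around it: inside, \<open>\<Phi> n\<close> omits
      every other point of \<open>P\<close>, so the minimum modulus principle applies.\<close>
  obtain K r where K: "compact K" "K \<subseteq> S" "\<And>n. \<exists>u\<in>K. norm (\<Phi> n u) \<le> r"
  proof (cases "z0 \<in> P")
    case False
    show ?thesis by (rule that[of "{z0}" "norm z0"]) (use False in \<open>auto simp: S_def fix\<Phi>\<close>)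
  next
    case True
    obtain q' where q': "q' \<in> P" "q' \<noteq> z0" using p q pq by metis
    obtain e where e: "e > 0" "cball z0 e - {z0} \<subseteq> S"
    proof -
      have "\<not> z0 islimpt P" using disc by (simp add: sparse_in_open)
      then obtain d where d: "d > 0" "\<forall>x\<in>P. x \<noteq> z0 \<longrightarrow> d \<le> dist x z0"
        unfolding islimpt_approachable by (metis not_le)
      show ?thesis
        by (rule that[of "d/2"]) (use d in \<open>force simp: S_def dist_commute\<close>)+
    qed
    \<comment> \<open>The circle always carries a point \<open>u\<close> at which
      \<open>\<Phi> n u\<close> is no farther from \<open>q'\<close> than the fixed value
      \<open>z0\<close> is; this bound is free of \<open>n\<close>.\<close>
    show ?thesis
    proof (rule that[of "sphere z0 e" "norm q' + norm (z0 - q')"])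
      show "sphere z0 e \<subseteq> S" using e by auto
      show "\<exists>u\<in>sphere z0 e. norm (\<Phi> n u) \<le> norm q' + norm (z0 - q')" for n
      proof (rule ccontr)
        assume neg: "\<not> ?thesis"
        have far: "norm (z0 - q') < norm (\<Phi> n u - q')" if "u \<in> sphere z0 e" for u
        proof -
          have "norm q' + norm (z0 - q') < norm (\<Phi> n u)" using neg that by (meson not_le)
          then show ?thesis using norm_triangle_ineq[of "\<Phi> n u - q'" q'] by simp
        qed
        have nz: "\<Phi> n u - q' \<noteq> 0" if "u \<in> cball z0 e" for u
        proof (cases "u = z0")
          case True then show ?thesis using q' fix\<Phi> by simp
        next
          case False
          then have "\<Phi> n u \<notin> P" using inv\<Phi> e(2) that by (auto simp: S_def)
          then show ?thesis using q' by auto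
        qed
        have "continuous_on (sphere z0 e) (\<lambda>u. norm (\<Phi> n u - q'))"
          by (intro continuous_intros holomorphic_on_imp_continuous_on hol\<Phi>)
        moreover have "sphere z0 e \<noteq> {}" using e by simp
        ultimately obtain v where v: "v \<in> sphere z0 e" 
            "\<forall>u\<in>sphere z0 e. norm (\<Phi> n v - q') \<le> norm (\<Phi> n u - q')"
          using continuous_attains_inf[OF compact_sphere] by (metis (no_types, lifting))
        have vpos: "norm (\<Phi> n v - q') > 0" using far[OF v(1)] norm_ge_zero le_less_trans by blast
        define G where "G = (\<lambda>u. inverse (\<Phi> n u - q'))"
        have holG: "G holomorphic_on cball z0 e"
          unfolding G_def by (intro holomorphic_intros hol\<Phi>) (use nz in auto)
        have "norm (G z0) \<le> inverse (norm (\<Phi> n v - q'))"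
        proof (rule maximum_modulus_frontier[of G "cball z0 e"])
          show "G holomorphic_on interior (cball z0 e)"
            using holG interior_subset holomorphic_on_subset by blast
          show "continuous_on (closure (cball z0 e)) G"
            using holG holomorphic_on_imp_continuous_on by simp
          show "norm (G u) \<le> inverse (norm (\<Phi> n v - q'))" if "u \<in> frontier (cball z0 e)" for u
            unfolding G_def norm_inverse
            by (rule le_imp_inverse_le) (use that v vpos e in auto)
        qed (use e in auto)
        then have "norm (\<Phi> n v - q') \<le> norm (z0 - q')"
          using vpos q' by (simp add: G_def fix\<Phi> norm_inverse inverse_le_iff_le)
        with far[OF v(1)] show False by simp
      qed
    qed simp
  qed
  obtain r0 where r0: "r0 > 0" "\<And>r n. r \<ge> r0 \<Longrightarrow> \<exists>z. norm z \<le> r \<and> norm ((\<phi> ^^ n) z) \<ge> 2 ^ n * r"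
    using nonaffine_iterates_unbounded[OF hol nonaff] by blast
  \<comment> \<open>The points of \<open>P\<close> have only countably many norms, so some circle of
    radius between \<open>r0\<close> and \<open>r0 + 1\<close> avoids \<open>P\<close>.\<close>
  obtain \<rho> where \<rho>: "\<rho> \<ge> r0" "sphere 0 \<rho> \<subseteq> S"
  proof -
    have "countable (norm ` P)" using cntP by simp
    then have "\<not> {r0<..<r0 + 1} \<subseteq> norm ` P"
      using uncountable_open_interval[of r0 "r0 + 1"] countable_subset by auto
    then obtain \<rho> where \<rho>: "r0 < \<rho>" "\<rho> \<notin> norm ` P"
      by (meson greaterThanLessThan_iff subsetI)
    then have "sphere 0 \<rho> \<subseteq> S" by (auto simp: S_def)
    then show ?thesis using that[of \<rho>] \<rho>(1) by simp
  qed
  obtain B where B: "\<forall>h u v. h holomorphic_on S \<longrightarrow> (\<forall>x\<in>S. h x \<noteq> p \<and> h x \<noteq> q) \<longrightarrow>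
      u \<in> K \<longrightarrow> v \<in> sphere 0 \<rho> \<longrightarrow> norm (h u) \<le> r \<longrightarrow> norm (h v) \<le> B"
    using omitting_two_values_bounded[OF S pq K(1,2) compact_sphere \<rho>(2), of r] by (elim exE)
  \<comment> \<open>Two values are omitted only off \<open>P\<close>, but \<open>\<Phi> n\<close> is
    entire, so the bound on the circle extends to the whole disc.\<close>
  have bound: "norm (\<Phi> n v) \<le> B" if "norm v \<le> \<rho>" for n v
  proof (rule maximum_modulus_frontier[of "\<Phi> n" "cball 0 \<rho>"])
    show "continuous_on (closure (cball 0 \<rho>)) (\<Phi> n)"
      by (intro holomorphic_on_imp_continuous_on hol\<Phi>)
    obtain u where "u \<in> K" "norm (\<Phi> n u) \<le> r" using K(3) by blast
    then show "norm (\<Phi> n x) \<le> B" if "x \<in> frontier (cball 0 \<rho>)" for x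
      using that omit \<rho>(1) r0(1) by (intro B[rule_format, of "\<Phi> n" u x] hol\<Phi>) auto
  qed (use that hol\<Phi> in auto)
  obtain n where n: "B / \<rho> < 2 ^ n" using real_arch_pow[of 2 "B / \<rho>"] by auto
  have "\<rho> > 0" using r0 \<rho> by simp
  obtain z where z: "norm z \<le> \<rho>" "norm ((\<phi> ^^ (2 * n)) z) \<ge> 2 ^ (2 * n) * \<rho>" using r0(2)[OF \<rho>(1)] by blast
  have "(2::real) ^ n \<le> 2 ^ (2 * n)" by (intro power_increasing) auto
  then have "B / \<rho> < 2 ^ (2 * n)" using n by linarith
  then have "B < 2 ^ (2 * n) * \<rho>" using \<open>\<rho> > 0\<close> by (simp add: divide_less_eq)
  then show False using bound[OF z(1), of n] z(2) by (simp add: \<Phi>_def)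
qed

section \<open>The functional equation in one variable\<close>

text \<open>Each step enlarges the radius by \<open>2 * D\<close> but the bound only by
  \<open>D\<close>. After \<open>j\<close> steps Cauchy's estimate for the derivative has gained a
  factor \<open>2 ^ j\<close>. Adding 1 to the bounds makes the recursion purely
  multiplicative.\<close>

lemma entire_sublinear_growth_imp_constant:
  assumes hol: "h holomorphic_on UNIV" and D: "D \<ge> 1" and R0: "R0 > 0"
    and step: "\<And>R B. R \<ge> R0 \<Longrightarrow> \<forall>z. norm z \<le> R \<longrightarrow> norm (h z) \<le> B \<Longrightarrow>
                  \<forall>z. norm z \<le> 2 * D * R \<longrightarrow> norm (h z) + 1 \<le> D * (B + 1)"
  shows "\<exists>\<beta>. \<forall>z. h z = \<beta>"
proof -
  have cont: "continuous_on A h" for A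
    using hol holomorphic_on_imp_continuous_on holomorphic_on_subset by blast
  have "bounded (h ` cball 0 R0)"
    by (intro compact_imp_bounded compact_continuous_image cont compact_cball)
  then obtain B where B: "\<And>z. norm z \<le> R0 \<Longrightarrow> norm (h z) \<le> B"
    unfolding bounded_iff by (metis image_eqI mem_cball_0)
  have iter: "norm (h z) + 1 \<le> D ^ j * (B + 1)" if "norm z \<le> (2 * D) ^ j * R0" for j z
    using that
  proof (induction j arbitrary: z)
    case 0
    then show ?case using B by simp
  next
    case (Suc j)
    have "1 \<le> (2 * D) ^ j" using D by (intro one_le_power) auto
    then have R: "(2 * D) ^ j * R0 \<ge> R0" using R0 by simp
    have "\<forall>z. norm z \<le> (2 * D) ^ j * R0 \<longrightarrow> norm (h z) \<le> D ^ j * (B + 1) - 1"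
      using Suc.IH by force
    from step[OF R this, rule_format, of z] Suc.prems show ?case
      by (simp add: algebra_simps)
  qed
  have B0: "B \<ge> 0" using B[of 0] R0 norm_ge_zero[of "h 0"] by (simp del: norm_ge_zero)
  have "deriv h w = 0" for w
  proof -
    define E where "E = 2 * (B + 1) / R0"
    have E: "E \<ge> 0" using B0 R0 by (simp add: E_def)
    have ev: "norm (deriv h w) \<le> E / 2 ^ j" if "2 ^ j \<ge> 2 * norm w / R0" for j
    proof -
      define R where "R = (2 * D) ^ j * R0"
      have "(2::real) ^ j \<le> (2 * D) ^ j" using D by (intro power_mono) auto
      then have "2 ^ j * R0 \<le> R" using R0 unfolding R_def by (intro mult_right_mono) auto
      moreover have "2 * norm w \<le> 2 ^ j * R0" using that R0 by (simp add: divide_le_eq)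
      ultimately have R: "2 * norm w \<le> R" by linarith
      have Rpos: "R > 0" using R0 D by (simp add: R_def)
      have "norm ((deriv ^^ 1) h w) \<le> fact 1 * (D ^ j * (B + 1)) / (R/2) ^ 1"
      proof (rule Cauchy_inequality)
        show "h holomorphic_on ball w (R/2)" using hol holomorphic_on_subset by blast
        show "norm (h x) \<le> D ^ j * (B + 1)" if "norm (w - x) = R/2" for x
        proof -
          have "norm x \<le> R" using that R norm_triangle_ineq3[of w x] by linarith
          from iter[of x j] this show ?thesis by (simp add: R_def)
        qed
      qed (use cont Rpos in auto)
      also have "\<dots> = E / 2 ^ j"
        using R0 D by (simp add: E_def R_def power_mult_distrib field_simps)
      finally show ?thesis by simp
    qed
    obtain k where k: "2 * norm w / R0 < 2 ^ k" using real_arch_pow[of 2] by auto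
    have "(\<lambda>j. E / 2 ^ j) \<longlonglongrightarrow> 0" by real_asymp
    moreover have "eventually (\<lambda>j. norm (deriv h w) \<le> E / 2 ^ j) sequentially"
    proof (rule eventually_sequentiallyI[of k])
      fix j assume "k \<le> j"
      then have "(2::real) ^ k \<le> 2 ^ j" by (intro power_increasing) auto
      then show "norm (deriv h w) \<le> E / 2 ^ j" using k by (intro ev) linarith
    qed
    ultimately have "norm (deriv h w) \<le> 0"
      by (rule tendsto_lowerbound) simp
    then show ?thesis by simp
  qed
  then have "(h has_field_derivative 0) (at z)" for z
    using holomorphic_derivI[OF hol, of z] by simp
  then obtain c where "\<And>z. h z = c"
    using has_field_derivative_zero_constant[of UNIV h] by auto
  then show ?thesis by blast
qed

text \<open>If \<open>h\<close> is bounded by \<open>B\<close> on the disc of radius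
  \<open>R = 2 * r\<close>, then \<open>h\<close> and its derivative are bounded by \<open>B\<close>
  on the disc of radius \<open>r\<close>, and the equation bounds \<open>h (\<phi> s)\<close> by
  \<open>C * (B + 1)\<close> at the relevant \<open>s\<close>. Surrounding with factor
  \<open>4 * D\<close> carries this to the disc of radius \<open>2 * D * R\<close>. The choice
  \<open>\<alpha> = 0\<close> serves the pole-free case.\<close>

lemma entire_part_constant:
  fixes a b c \<alpha> w0 :: complex
  assumes hol: "\<phi> holomorphic_on UNIV" and nonaff: "\<not> (\<exists>A B. \<forall>z. \<phi> z = A * z + B)"
    and holh: "h holomorphic_on UNIV" and a: "a \<noteq> 0"
    and eq: "\<And>s. s \<noteq> w0 \<Longrightarrow> \<phi> s \<noteq> w0 \<Longrightarrow>
      deriv h s - \<alpha> / (s - w0)\<^sup>2 = a * (h (\<phi> s) + \<alpha> / (\<phi> s - w0)) + b * (h s + \<alpha> / (s - w0)) + c"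
  shows "\<exists>\<beta>. \<forall>z. h z = \<beta>"
proof -
  have "isCont \<phi> w0"
    using hol holomorphic_on_imp_continuous_on continuous_on_eq_continuous_at open_UNIV by blast
  \<comment> \<open>Within \<open>\<delta>\<close> of \<open>w0\<close> the values of
    \<open>\<phi>\<close> are too small for the points \<open>s\<close> used below, so the terms
    with denominator \<open>s - w0\<close> stay bounded.\<close>
  then obtain \<delta> where \<delta>: "\<delta> > 0" "\<And>s. dist s w0 < \<delta> \<Longrightarrow> dist (\<phi> s) (\<phi> w0) < 1"
    unfolding continuous_at_eps_delta by (metis zero_less_one)
  define C where "C = norm \<alpha> + (1 + norm \<alpha> / \<delta>\<^sup>2 + norm b * (1 + norm \<alpha> / \<delta>) + norm c) / norm a"
  have C: "C \<ge> 0" using \<delta>(1) by (simp add: C_def)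
  \<comment> \<open>\<open>C\<close> must not depend on the expansion factor \<open>4 * D\<close> chosen next.\<close>
  define D where "D = C + 1"
  \<comment> \<open>Values of \<open>\<phi>\<close> of norm at least \<open>M\<close> have distance
    at least 1 from \<open>w0\<close> and more than 1 from \<open>\<phi> w0\<close>.\<close>
  define M where "M = norm (\<phi> w0) + norm w0 + 2"
  obtain r0 where r0: "r0 > 0"
    "\<And>r (h :: complex \<Rightarrow> complex) w. r \<ge> r0 \<Longrightarrow> h holomorphic_on UNIV \<Longrightarrow> norm w \<le> (4 * D) * r \<Longrightarrow>
       \<exists>z. norm z \<le> r \<and> norm (h w) \<le> norm (h (\<phi> z)) \<and> (4 * D) * r \<le> norm (\<phi> z)"
    using nonaffine_image_surrounds[OF hol nonaff, of "4 * D"] C by (auto simp: D_def)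
  define R0 where "R0 = 2 * max r0 (max 1 M)"
  show ?thesis
  proof (rule entire_sublinear_growth_imp_constant[OF holh])
    show "D \<ge> 1" using C by (simp add: D_def)
    show "R0 > 0" using r0(1) by (simp add: R0_def)
    fix R B assume R: "R \<ge> R0" and B: "\<forall>z. norm z \<le> R \<longrightarrow> norm (h z) \<le> B"
    define r where "r = R / 2"
    have r: "r \<ge> r0" "r \<ge> 1" "r \<ge> M" using R by (auto simp: r_def R0_def)
    have "norm (h 0) \<le> B" using B r by (auto simp: r_def)
    then have B0: "B \<ge> 0" using norm_ge_zero order_trans by blast
    show "\<forall>w. norm w \<le> 2 * D * R \<longrightarrow> norm (h w) + 1 \<le> D * (B + 1)"
    proof (intro allI impI)
      fix w :: complex assume w: "norm w \<le> 2 * D * R"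
      obtain s where s: "norm s \<le> r" "norm (h w) \<le> norm (h (\<phi> s))" "4 * D * r \<le> norm (\<phi> s)"
        using r0(2)[OF r(1) holh, of w] w by (auto simp: r_def)
      have "r \<le> 4 * D * r" using r C by (simp add: D_def)
      then have big: "norm (\<phi> s) \<ge> M" using s(3) r by linarith
      have sd: "norm (s - w0) \<ge> \<delta>"
      proof (rule ccontr)
        assume "\<not> ?thesis"
        then have "norm (\<phi> s - \<phi> w0) < 1" using \<delta>(2)[of s] by (simp add: dist_norm)
        then have "norm (\<phi> s) < norm (\<phi> w0) + 1" using norm_triangle_ineq2[of "\<phi> s" "\<phi> w0"] by linarith
        then show False using big norm_ge_zero[of w0] unfolding M_def by linarith
      qed
      have fd: "norm (\<phi> s - w0) \<ge> 1"
        using big norm_triangle_ineq2[of "\<phi> s" w0] norm_ge_zero[of "\<phi> w0"] unfolding M_def by linarith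
      have hs: "norm (h s) \<le> B" using B s(1) r by (auto simp: r_def)
      have "norm ((deriv ^^ 1) h s) \<le> fact 1 * B / r ^ 1"
      proof (rule Cauchy_inequality)
        show "h holomorphic_on ball s r" using holh holomorphic_on_subset by blast
        show "continuous_on (cball s r) h"
          using holh holomorphic_on_imp_continuous_on holomorphic_on_subset by blast
        show "norm (h x) \<le> B" if "norm (s - x) = r" for x
        proof -
          have "norm x \<le> R" using that s(1) norm_triangle_ineq3[of s x] unfolding r_def by linarith
          then show ?thesis using B by blast
        qed
      qed (use r in auto)
      also have "\<dots> \<le> B" using B0 r by (simp add: divide_le_eq mult_left_le mult_le_cancel_left1)
      finally have dhs: "norm (deriv h s) \<le> B" by simp
      have ns: "s \<noteq> w0" "\<phi> s \<noteq> w0" using sd fd \<delta>(1) by auto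
      have "a * h (\<phi> s) = deriv h s - \<alpha> / (s - w0)\<^sup>2 - b * (h s + \<alpha> / (s - w0)) - c - a * (\<alpha> / (\<phi> s - w0))"
        using eq[OF ns] by (simp add: algebra_simps)
      also have "norm \<dots> \<le> norm (deriv h s) + norm (\<alpha> / (s - w0)\<^sup>2) + norm (b * (h s + \<alpha> / (s - w0))) 
          + norm c + norm (a * (\<alpha> / (\<phi> s - w0)))"
        by (intro norm_triangle_le_diff add_mono order_refl)
      also have "\<dots> \<le> B + norm \<alpha> / \<delta>\<^sup>2 + norm b * (B + norm \<alpha> / \<delta>) + norm c + norm a * norm \<alpha>"
      proof (intro add_mono dhs order_refl)
        show "norm (\<alpha> / (s - w0)\<^sup>2) \<le> norm \<alpha> / \<delta>\<^sup>2"
          unfolding norm_divide norm_power using sd \<delta>(1) by (intro divide_left_mono power_mono) (auto simp: ns)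
        have "norm (\<alpha> / (s - w0)) \<le> norm \<alpha> / \<delta>"
          unfolding norm_divide using sd \<delta>(1) by (intro divide_left_mono) (auto simp: ns)
        then have "norm (h s + \<alpha> / (s - w0)) \<le> B + norm \<alpha> / \<delta>"
          using hs by (intro norm_triangle_le) auto
        then show "norm (b * (h s + \<alpha> / (s - w0))) \<le> norm b * (B + norm \<alpha> / \<delta>)"
          unfolding norm_mult by (intro mult_left_mono) auto
        have "norm (\<alpha> / (\<phi> s - w0)) \<le> norm \<alpha>"
          unfolding norm_divide using fd ns by (simp add: divide_le_eq mult_le_cancel_left1)
        then show "norm (a * (\<alpha> / (\<phi> s - w0))) \<le> norm a * norm \<alpha>"
          unfolding norm_mult by (intro mult_left_mono) auto
      qed
      also have "\<dots> \<le> norm a * (C * (B + 1))"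
      proof -
        define x where "x = norm \<alpha> / \<delta>\<^sup>2"
        define y where "y = norm \<alpha> / \<delta>"
        have xy: "x \<ge> 0" "y \<ge> 0" using \<delta>(1) by (auto simp: x_def y_def)
        have "norm a * (C * (B + 1)) = norm a * norm \<alpha> * (B + 1) + (1 + x + norm b * (1 + y) + norm c) * (B + 1)"
          using a by (simp add: C_def x_def y_def field_simps)
        also have "\<dots> = (B + x + norm b * (B + y) + norm c + norm a * norm \<alpha>) +
           (norm a * norm \<alpha> * B + 1 + x * B + norm b * (1 + y * B) + norm c * B)"
          by (simp add: algebra_simps)
        also have "\<dots> \<ge> B + x + norm b * (B + y) + norm c + norm a * norm \<alpha>"
          using xy B0 by simp
        finally show ?thesis by (simp add: x_def y_def)
      qed
      finally have "norm (h (\<phi> s)) \<le> C * (B + 1)" using a by (simp add: norm_mult)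
      then show "norm (h w) + 1 \<le> D * (B + 1)" using s(2) B0 by (simp add: D_def algebra_simps)
    qed
  qed
qed

text \<open>Clearing denominators, with \<open>t = s - w0\<close>, gives
  \<open>\<phi> s - w0\<close> times a polynomial of degree at most 2 equal to
  \<open>- a * \<alpha> * t\<^sup>2\<close>. That polynomial has no zero, so by the fundamental
  theorem of algebra it is the constant \<open>\<alpha>\<close>.\<close>

lemma simple_pole_solution:
  fixes a b c \<alpha> \<beta> w0 :: complex
  assumes a: "a \<noteq> 0" and \<alpha>: "\<alpha> \<noteq> 0" and \<phi>0: "\<And>s. \<phi> s = w0 \<longleftrightarrow> s = w0"
    and eq: "\<And>s. s \<noteq> w0 \<Longrightarrow> \<phi> s \<noteq> w0 \<Longrightarrow>
      - \<alpha> / (s - w0)\<^sup>2 = a * (\<beta> + \<alpha> / (\<phi> s - w0)) + b * (\<beta> + \<alpha> / (s - w0)) + c"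
  shows "b = 0 \<and> a * \<beta> + c = 0 \<and> (\<forall>z. \<phi> z = w0 - a * (z - w0)\<^sup>2)"
proof -
  define \<kappa> where "\<kappa> = a * \<beta> + b * \<beta> + c"
  have key: "(\<phi> (w0 + t) - w0) * (\<alpha> + b * \<alpha> * t + \<kappa> * t\<^sup>2) = - a * \<alpha> * t\<^sup>2" for t
  proof (cases "t = 0")
    case True then show ?thesis using \<phi>0 by simp
  next
    case False
    then have "w0 + t \<noteq> w0" "\<phi> (w0 + t) \<noteq> w0" using \<phi>0 by auto
    from eq[OF this] False this(2) show ?thesis
      by (simp add: \<kappa>_def field_simps power2_eq_square)
  qed
  have noroot: "\<alpha> + b * \<alpha> * t + \<kappa> * t\<^sup>2 \<noteq> 0" for t
    using key[of t] a \<alpha> by (cases "t = 0") auto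
  define co where "co = (\<lambda>i::nat. if i = 0 then \<alpha> else if i = 1 then b * \<alpha> else \<kappa>)"
  have "\<not> (\<exists>i\<in>{1..2}. co i \<noteq> 0)"
  proof
    assume "\<exists>i\<in>{1..2}. co i \<noteq> 0"
    then obtain t where "(\<Sum>i\<le>2. co i * t ^ i) = 0"
      using fundamental_theorem_of_algebra[of co 2] by metis
    then show False using noroot[of t] by (simp add: co_def numeral_2_eq_2)
  qed
  then have "co 1 = 0" "co 2 = 0" by auto
  then have \<kappa>0: "\<kappa> = 0" and "b * \<alpha> = 0" by (simp_all add: co_def)
  then have b: "b = 0" using \<alpha> by simp
  have "\<phi> z = w0 - a * (z - w0)\<^sup>2" for z
  proof -
    have "(\<phi> z - w0) * \<alpha> = - a * (z - w0)\<^sup>2 * \<alpha>" using key[of "z - w0"] b \<kappa>0 by (simp add: algebra_simps)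
    then have "\<phi> z - w0 = - a * (z - w0)\<^sup>2" using \<alpha> by (metis mult_right_cancel)
    then show ?thesis by (simp add: algebra_simps)
  qed
  then show ?thesis using b \<kappa>0 by (simp add: \<kappa>_def)
qed

section \<open>Local behaviour at zeros and poles, and the non-affine case\<close>

text \<open>The values of a non-constant \<open>\<phi>\<close> near \<open>s\<close> avoid
  \<open>\<phi> s\<close> itself, so statements about \<open>f\<close> on punctured neighbourhoods
  of \<open>\<phi> s\<close> can be composed with \<open>\<phi>\<close>.\<close>

lemma nonconstant_entire_filterlim_at:
  assumes hol: "\<phi> holomorphic_on UNIV" and nc: "\<not> \<phi> constant_on UNIV"
  shows "filterlim \<phi> (at (\<phi> s)) (at s)"
proof -
  obtain u where u: "\<phi> u \<noteq> \<phi> s" using nc unfolding constant_on_def by blast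
  obtain r where r: "r > 0" "\<And>z. z \<in> ball s r - {s} \<Longrightarrow> \<phi> z - \<phi> s \<noteq> 0"
  proof (rule isolated_zeros[of "\<lambda>z. \<phi> z - \<phi> s" UNIV s u])
    show "(\<lambda>z. \<phi> z - \<phi> s) holomorphic_on UNIV" by (intro holomorphic_intros hol)
  qed (use u in auto)
  have "eventually (\<lambda>z. \<phi> z \<noteq> \<phi> s) (at s)"
    unfolding eventually_at using r by (intro exI[of _ r]) (auto simp: dist_commute)
  moreover have "isCont \<phi> s"
    using hol holomorphic_on_imp_continuous_on continuous_on_eq_continuous_at open_UNIV by blast
  then have "(\<phi> \<longlongrightarrow> \<phi> s) (at s)" by (simp add: isCont_def)
  ultimately show ?thesis by (simp add: filterlim_at)
qed

text \<open>Write \<open>f = g / (w - s) ^ N\<close> with \<open>g s \<noteq> 0\<close>.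
  Differentiation raises the order of the pole by exactly one, and the terms with \<open>b\<close>
  and \<open>c\<close> disappear in the limit; they are included to match the functional
  equation.\<close>

lemma pole_asymptotics:
  fixes f :: "complex \<Rightarrow> complex"
  assumes pole: "is_pole f s" and iso: "isolated_singularity_at f s"
  shows "\<exists>N U. N > 0 \<and> U \<noteq> 0 \<and> ((\<lambda>w. (w - s) ^ N * f w) \<longlongrightarrow> U) (at s) \<and>
    ((\<lambda>w. (w - s) ^ Suc N * (deriv f w - b * f w - c)) \<longlongrightarrow> - of_nat N * U) (at s)"
proof -
  obtain R where R: "R > 0" "f analytic_on ball s R - {s}"
    using iso unfolding isolated_singularity_at_def by blast
  then have "f holomorphic_on ball s R - {s}" using analytic_imp_holomorphic by blast
  define g where "g = zor_poly f s"
  define N where "N = nat (- zorder f s)"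
  obtain r where neg: "zorder f s < 0" and gs: "g s \<noteq> 0" and r: "r > 0" "cball s r \<subseteq> ball s R"
      "g holomorphic_on cball s r" "\<And>w. w \<in> cball s r - {s} \<Longrightarrow> f w = g w / (w - s) ^ N"
    using zorder_exist_pole[OF \<open>f holomorphic_on ball s R - {s}\<close> open_ball _ pole] R(1)
    unfolding g_def N_def by auto
  have N: "N > 0" using neg by (simp add: N_def)
  have holg: "g holomorphic_on ball s r" using r(3) by (meson ball_subset_cball holomorphic_on_subset)
  have cg: "(g \<longlongrightarrow> g s) (at s)" "(deriv g \<longlongrightarrow> deriv g s) (at s)"
    using holomorphic_on_imp_continuous_on[OF holg]
          holomorphic_on_imp_continuous_on[OF holomorphic_deriv[OF holg open_ball]] r(1)
    by (simp_all add: continuous_on_eq_continuous_at isCont_def)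
  have ev: "eventually (\<lambda>w. w \<in> ball s r - {s}) (at s)"
    using r(1) by (intro eventually_at_in_open) auto
  show ?thesis
  proof (intro exI[of _ N] exI[of _ "g s"] conjI N gs)
    show "((\<lambda>w. (w - s) ^ N * f w) \<longlongrightarrow> g s) (at s)"
      by (rule Lim_transform_eventually[OF cg(1)])
        (use ev in eventually_elim, use r(4) in auto)
    have "((\<lambda>w. (w - s) * deriv g w - of_nat N * g w - b * (w - s) * g w - (w - s) ^ Suc N * c) \<longlongrightarrow>
       (s - s) * deriv g s - of_nat N * g s - b * (s - s) * g s - (s - s) ^ Suc N * c) (at s)"
      by (intro tendsto_intros cg)
    then have "((\<lambda>w. (w - s) * deriv g w - of_nat N * g w - b * (w - s) * g w - (w - s) ^ Suc N * c) \<longlongrightarrow>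
       - of_nat N * g s) (at s)" by simp
    then show "((\<lambda>w. (w - s) ^ Suc N * (deriv f w - b * f w - c)) \<longlongrightarrow> - of_nat N * g s) (at s)"
    proof (rule Lim_transform_eventually)
      show "\<forall>\<^sub>F w in at s. (w - s) * deriv g w - of_nat N * g w - b * (w - s) * g w - (w - s) ^ Suc N * c =
          (w - s) ^ Suc N * (deriv f w - b * f w - c)"
        using ev
      proof eventually_elim
        case (elim w)
        then have w: "w \<noteq> s" "w \<in> ball s r" by auto
        have op: "open (ball s r - {s})" by auto
        obtain M where M: "N = Suc M" using N not0_implies_Suc by blast
        have dg: "(g has_field_derivative deriv g w) (at w)"
          using holomorphic_derivI[OF holg open_ball w(2)] .
        have "((\<lambda>w. g w / (w - s) ^ N) has_field_derivative
            (deriv g w * (w - s) ^ N - g w * (of_nat N * (w - s) ^ M)) / ((w - s) ^ N * (w - s) ^ N)) (at w)"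
          by (rule derivative_eq_intros dg refl | use w M in simp)+
        then have "(f has_field_derivative
            (deriv g w * (w - s) ^ N - g w * (of_nat N * (w - s) ^ M)) / ((w - s) ^ N * (w - s) ^ N)) (at w)"
          by (rule has_field_derivative_transform_within_open[OF _ op elim]) (use r(4) in auto)
        then have df: "deriv f w = (deriv g w * (w - s) ^ N - g w * (of_nat N * (w - s) ^ M)) / ((w - s) ^ N * (w - s) ^ N)"
          by (rule DERIV_imp_deriv)
        have fw: "f w = g w / (w - s) ^ N" using r(4) w by auto
        define t where "t = w - s"
        have t: "t \<noteq> 0" using w by (simp add: t_def)
        have "t ^ Suc N * ((deriv g w * t ^ N - g w * (of_nat N * t ^ M)) / (t ^ N * t ^ N)) = t * deriv g w - of_nat N * g w"
          using t by (simp add: M field_simps)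
        moreover have "t ^ Suc N * (b * (g w / t ^ N)) = b * t * g w" using t by (simp add: M field_simps)
        ultimately show ?case unfolding df fw t_def[symmetric] by (simp only: right_diff_distrib)
      qed
    qed
  qed
qed

text \<open>Uniqueness of the pole order: multiplying by a further positive power of
  \<open>w - s\<close> turns a finite limit into 0.\<close>

lemma power_mult_tendsto_unique:
  fixes F :: "complex \<Rightarrow> complex"
  assumes "((\<lambda>w. (w - s) ^ m * F w) \<longlongrightarrow> x) (at s)" "x \<noteq> 0"
    and "((\<lambda>w. (w - s) ^ n * F w) \<longlongrightarrow> y) (at s)" "y \<noteq> 0"
  shows "m = n"
proof -
  have aux: "\<not> m < n" if mx: "((\<lambda>w. (w - s) ^ m * F w) \<longlongrightarrow> x) (at s)"
    and ny: "((\<lambda>w. (w - s) ^ n * F w) \<longlongrightarrow> y) (at s)" "y \<noteq> 0" for m n x y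
  proof
    assume "m < n"
    then obtain k where k: "n = m + Suc k" using less_imp_Suc_add by auto
    have "((\<lambda>w. (w - s) ^ Suc k * ((w - s) ^ m * F w)) \<longlongrightarrow> (s - s) ^ Suc k * x) (at s)"
      by (intro tendsto_intros mx)
    moreover have "(\<lambda>w. (w - s) ^ Suc k * ((w - s) ^ m * F w)) = (\<lambda>w. (w - s) ^ n * F w)"
      by (simp add: k power_add mult_ac fun_eq_iff)
    ultimately have "((\<lambda>w. (w - s) ^ n * F w) \<longlongrightarrow> 0) (at s)" by simp
    then show False using ny tendsto_unique[OF trivial_limit_at] by blast
  qed
  show ?thesis using aux[OF assms(1,3,4)] aux[OF assms(3,1,2)] by linarith
qed

text \<open>The equation is available only where \<open>f\<close> is analytic at both
  \<open>s\<close> and \<open>\<phi> s\<close>. Poles are therefore compared through limits, first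
  to locate them and then to find their order.\<close>

theorem functional_equation_solution:
  fixes f \<phi> :: "complex \<Rightarrow> complex" and a b c :: complex
  assumes mero: "f nicely_meromorphic_on UNIV" and nonconst: "\<not> (\<exists>k. \<forall>z. f z = k)"
    and hol: "\<phi> holomorphic_on UNIV" and nonaff: "\<not> (\<exists>A B. \<forall>z. \<phi> z = A * z + B)"
    and a: "a \<noteq> 0"
    and eq: "\<And>s. f analytic_on {s} \<Longrightarrow> f analytic_on {\<phi> s} \<Longrightarrow> deriv f s = a * f (\<phi> s) + b * f s + c"
  shows "\<exists>\<alpha> \<beta> w0. \<alpha> \<noteq> 0 \<and> (\<forall>z. z \<noteq> w0 \<longrightarrow> f z = \<beta> + \<alpha> / (z - w0)) \<and>
           (\<forall>z. \<phi> z = w0 - a * (z - w0)\<^sup>2) \<and> b = 0 \<and> a * \<beta> + c = 0"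
proof -
  define P where "P = {z. \<not> f analytic_on {z}}"
  have mer: "f meromorphic_on UNIV" using mero by (simp add: nicely_meromorphic_on_def)
  have sparse: "P sparse_in UNIV"
    unfolding P_def using mer by (rule meromorphic_on_imp_sparse_singularities)
  have evP: "eventually (\<lambda>w. w \<notin> P) (at s)" for s
    using sparse by (simp add: sparse_in_open islimpt_iff_eventually)
  have pole: "is_pole f s" if "s \<in> P" for s
    using nicely_meromorphic_on_imp_analytic_at[OF mero, of s] that by (auto simp: P_def)
  have iso: "isolated_singularity_at f s" for s
    using mer meromorphic_on_isolated_singularity meromorphic_on_subset by blast
  have nc: "\<not> \<phi> constant_on UNIV"
    using nonaff unfolding constant_on_def by (metis UNIV_I add.left_neutral mult_zero_left)
  note lim\<phi> = nonconstant_entire_filterlim_at[OF hol nc]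
  have cont\<phi>: "(\<phi> \<longlongrightarrow> \<phi> s) (at s)" for s using lim\<phi> by (simp add: filterlim_at)
  have ev\<phi>P: "eventually (\<lambda>w. \<phi> w \<notin> P) (at s)" for s
    using evP lim\<phi> by (rule eventually_compose_filterlim)
  \<comment> \<open>The excluded points are isolated, so the equation holds on a punctured
    neighbourhood of every \<open>s\<close>, poles included.\<close>
  have eveq: "eventually (\<lambda>w. deriv f w - b * f w - c = a * f (\<phi> w)) (at s)" for s
    using evP[of s] ev\<phi>P[of s] 
  proof eventually_elim
    case (elim w)
    then show ?case using eq[of w] by (simp add: P_def algebra_simps)
  qed
  \<comment> \<open>A pole on exactly one side is impossible: either \<open>f (\<phi> w)\<close>
    tends to infinity against a finite limit, or it is bounded against a pole of order
    \<open>N + 1\<close>.\<close>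
  have inv: "\<phi> s \<in> P \<longleftrightarrow> s \<in> P" for s
  proof
    assume \<phi>s: "\<phi> s \<in> P"
    show "s \<in> P"
    proof (rule ccontr)
      assume "s \<notin> P"
      then have an: "f analytic_on {s}" by (simp add: P_def)
      then have "deriv f analytic_on {s}" by (rule analytic_deriv)
      then have "isCont (deriv f) s" "isCont f s" using an analytic_at_imp_isCont by auto
      then have "((\<lambda>w. (deriv f w - b * f w - c) / a) \<longlongrightarrow> (deriv f s - b * f s - c) / a) (at s)"
        using a by (intro tendsto_intros) (auto simp: isCont_def)
      then have "((\<lambda>w. f (\<phi> w)) \<longlongrightarrow> (deriv f s - b * f s - c) / a) (at s)"
        by (rule Lim_transform_eventually) (use eveq[of s] a in \<open>auto elim!: eventually_mono\<close>)
      moreover have "filterlim (\<lambda>w. f (\<phi> w)) at_infinity (at s)"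
        using pole[OF \<phi>s] lim\<phi>[of s] unfolding is_pole_def by (rule filterlim_compose)
      ultimately show False using not_tendsto_and_filterlim_at_infinity trivial_limit_at by blast
    qed
  next
    assume s: "s \<in> P"
    show "\<phi> s \<in> P"
    proof (rule ccontr)
      assume "\<phi> s \<notin> P"
      then have "isCont f (\<phi> s)" using analytic_at_imp_isCont by (auto simp: P_def)
      then have fl: "((\<lambda>w. f (\<phi> w)) \<longlongrightarrow> f (\<phi> s)) (at s)"
        using cont\<phi> by (rule isCont_tendsto_compose)
      obtain N U where NU: "N > 0" "U \<noteq> 0" 
        "((\<lambda>w. (w - s) ^ Suc N * (deriv f w - b * f w - c)) \<longlongrightarrow> - of_nat N * U) (at s)"
        using pole_asymptotics[OF pole[OF s] iso, of b c] by blast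
      have "((\<lambda>w. (w - s) ^ Suc N * (a * f (\<phi> w))) \<longlongrightarrow> (s - s) ^ Suc N * (a * f (\<phi> s))) (at s)"
        by (intro tendsto_intros fl)
      then have "((\<lambda>w. (w - s) ^ Suc N * (a * f (\<phi> w))) \<longlongrightarrow> 0) (at s)" by simp
      then have "((\<lambda>w. (w - s) ^ Suc N * (deriv f w - b * f w - c)) \<longlongrightarrow> 0) (at s)"
        by (rule Lim_transform_eventually) (use eveq[of s] in \<open>auto elim!: eventually_mono\<close>)
      then show False using NU tendsto_unique[OF trivial_limit_at] by force
    qed
  qed
  have one: "p = q" if "p \<in> P" "q \<in> P" for p q
    using completely_invariant_discrete_set_le_one[OF hol nonaff sparse inv that] .
  show ?thesis
  proof (cases "P = {}")
    case True
    then have an: "f analytic_on {s}" for s by (auto simp: P_def)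
    then have holf: "f holomorphic_on UNIV"
      using analytic_on_analytic_at analytic_imp_holomorphic by blast
    have "\<exists>\<beta>. \<forall>z. f z = \<beta>"
      by (rule entire_part_constant[of \<phi> f a 0 0 b c, OF hol nonaff holf a])
        (use eq an in auto)
    with nonconst show ?thesis by blast
  next
    case False
    then obtain w0 where w0: "w0 \<in> P" by blast
    then have P: "P = {w0}" using one by blast
    have \<phi>0: "\<phi> s = w0 \<longleftrightarrow> s = w0" for s using inv[of s] P by auto
    obtain N U where NU: "N > 0" "U \<noteq> 0" "((\<lambda>w. (w - w0) ^ N * f w) \<longlongrightarrow> U) (at w0)"
        "((\<lambda>w. (w - w0) ^ Suc N * (deriv f w - b * f w - c)) \<longlongrightarrow> - of_nat N * U) (at w0)"
      using pole_asymptotics[OF pole[OF w0] iso, of b c] by blast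
    obtain g r e where g: "e > 0" "r > 0" "g holomorphic_on ball w0 r"
        "\<And>w. w \<in> ball w0 r \<Longrightarrow> \<phi> w - w0 = (w - w0) ^ e * g w" "\<And>w. w \<in> ball w0 r \<Longrightarrow> g w \<noteq> 0"
    proof (rule holomorphic_factor_zero_nonconstant[of "\<lambda>z. \<phi> z - w0" UNIV w0])
      show "\<not> (\<lambda>z. \<phi> z - w0) constant_on UNIV"
        using nc unfolding constant_on_def by (metis UNIV_I diff_add_cancel)
    qed (use hol \<phi>0 in \<open>auto intro!: holomorphic_intros\<close>)
    \<comment> \<open>If \<open>e\<close> is the multiplicity of \<open>w0\<close> as a zero of
      \<open>\<phi> - w0\<close>, the composition has a pole of order \<open>e * N\<close> and the
      derivative one of order \<open>N + 1\<close>. Equality makes \<open>N\<close> divide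
      1.\<close>
    have N1: "N = 1"
    proof -
      have gl: "(g \<longlongrightarrow> g w0) (at w0)"
        using holomorphic_on_imp_continuous_on[OF g(3)] g(2)
        by (simp add: continuous_on_eq_continuous_at isCont_def)
      have gne: "g w0 \<noteq> 0" using g by auto
      have "filterlim \<phi> (at w0) (at w0)" using lim\<phi>[of w0] \<phi>0[of w0] by simp
      from filterlim_compose[OF NU(3) this]
      have "((\<lambda>w. (\<phi> w - w0) ^ N * f (\<phi> w)) \<longlongrightarrow> U) (at w0)" .
      then have "((\<lambda>w. (\<phi> w - w0) ^ N * f (\<phi> w) / g w ^ N) \<longlongrightarrow> U / g w0 ^ N) (at w0)"
        using gne by (intro tendsto_intros gl) auto
      then have 1: "((\<lambda>w. (w - w0) ^ (e * N) * f (\<phi> w)) \<longlongrightarrow> U / g w0 ^ N) (at w0)"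
      proof (rule Lim_transform_eventually)
        have "eventually (\<lambda>w. w \<in> ball w0 r) (at w0)"
          using g(2) by (intro eventually_at_in_open') auto
        then show "\<forall>\<^sub>F w in at w0. (\<phi> w - w0) ^ N * f (\<phi> w) / g w ^ N = (w - w0) ^ (e * N) * f (\<phi> w)"
          by eventually_elim (simp add: g(4,5) power_mult_distrib power_mult)
      qed
      have "((\<lambda>w. (w - w0) ^ Suc N * (deriv f w - b * f w - c) / a) \<longlongrightarrow> - of_nat N * U / a) (at w0)"
        using a by (intro tendsto_intros NU(4)) auto
      then have 2: "((\<lambda>w. (w - w0) ^ Suc N * f (\<phi> w)) \<longlongrightarrow> - of_nat N * U / a) (at w0)"
        by (rule Lim_transform_eventually) (use eveq[of w0] a in \<open>auto elim!: eventually_mono\<close>)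
      have "e * N = Suc N"
        by (rule power_mult_tendsto_unique[OF 1 _ 2]) (use NU gne a in auto)
      then have "N dvd Suc N" by (metis dvd_triv_right)
      then have "N dvd 1" by (metis Suc_eq_plus1 dvd_add_right_iff dvd_refl)
      then show ?thesis by simp
    qed
    define u where "u = (\<lambda>z. if z = w0 then U else (z - w0) * f z)"
    have an: "f analytic_on {s}" if "s \<noteq> w0" for s using that P by (auto simp: P_def)
    then have "f analytic_on - {w0}" using analytic_on_analytic_at by blast
    then have holf: "f holomorphic_on UNIV - {w0}"
      using analytic_imp_holomorphic by (simp add: Compl_eq_Diff_UNIV)
    have holu: "u holomorphic_on UNIV"
    proof (rule no_isolated_singularity'[of "{w0}"])
      have "(\<lambda>z. (z - w0) * f z) holomorphic_on UNIV - {w0}"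
        by (intro holomorphic_intros holf)
      then show "u holomorphic_on UNIV - {w0}"
        by (rule holomorphic_transform) (auto simp: u_def)
      have "(u \<longlongrightarrow> U) (at w0)"
        by (rule Lim_transform_eventually[OF NU(3)]) 
          (auto simp: u_def N1 eventually_at_filter)
      then show "(u \<longlongrightarrow> u z) (at z within UNIV)" if "z \<in> {w0}" for z
        using that by (simp add: u_def)
    qed auto
    \<comment> \<open>Off \<open>w0\<close> this is the difference quotient of \<open>u\<close> at
      \<open>w0\<close>, hence the value \<open>deriv u w0\<close> there; the residue
      \<open>u w0\<close> is \<open>U\<close>.\<close>
    define h where "h = (\<lambda>z. if z = w0 then deriv u w0 else f z - u w0 / (z - w0))"
    have holh: "h holomorphic_on UNIV"
      unfolding h_def by (rule pole_theorem[OF holu]) (auto simp: u_def)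
    have fh: "f z = h z + U / (z - w0)" if "z \<noteq> w0" for z
      using that by (simp add: h_def u_def)
    have df: "deriv f s = deriv h s - U / (s - w0)\<^sup>2" if s: "s \<noteq> w0" for s
    proof (rule DERIV_imp_deriv)
      have "((\<lambda>z. h z + U / (z - w0)) has_field_derivative deriv h s - U / (s - w0)\<^sup>2) (at s)"
        using s holomorphic_derivI[OF holh open_UNIV UNIV_I, of s]
        by (auto intro!: derivative_eq_intros simp: power2_eq_square)
      then show "(f has_field_derivative deriv h s - U / (s - w0)\<^sup>2) (at s)"
        by (rule has_field_derivative_transform_within_open[of _ _ _ "- {w0}"]) (use s fh in auto)
    qed
    have heq: "deriv h s - U / (s - w0)\<^sup>2 = a * (h (\<phi> s) + U / (\<phi> s - w0)) + b * (h s + U / (s - w0)) + c"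
      if "s \<noteq> w0" "\<phi> s \<noteq> w0" for s
      using eq[OF an[OF that(1)] an[OF that(2)]] df[OF that(1)] fh[OF that(1)] fh[OF that(2)] by simp
    obtain \<beta> where \<beta>: "\<And>z. h z = \<beta>"
      using entire_part_constant[OF hol nonaff holh a heq] by blast
    have "h = (\<lambda>_. \<beta>)" using \<beta> by blast
    then have "deriv h s = 0" for s by simp
    then have "b = 0 \<and> a * \<beta> + c = 0 \<and> (\<forall>z. \<phi> z = w0 - a * (z - w0)\<^sup>2)"
      by (intro simple_pole_solution[OF a NU(2) \<phi>0]) (use heq \<beta> in auto)
    then show ?thesis using NU(2) fh \<beta> by (intro exI[of _ U] exI[of _ \<beta>] exI[of _ w0]) simp
  qed
qed

section \<open>Polynomials and entire functions of several variables\<close>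

text \<open>Finiteness makes the sum in \<open>poly_cn_deg_le\<close> a genuine one, since sums over
  infinite sets are 0 by convention.\<close>

lemma finite_exponents_le: "finite {e :: 'n::finite \<Rightarrow> nat. (\<Sum>j\<in>UNIV. e j) \<le> d}"
proof (rule finite_subset)
  show "{e :: 'n \<Rightarrow> nat. (\<Sum>j\<in>UNIV. e j) \<le> d} \<subseteq> UNIV \<rightarrow>\<^sub>E {..d}"
  proof
    fix e :: "'n \<Rightarrow> nat" assume "e \<in> {e. (\<Sum>j\<in>UNIV. e j) \<le> d}"
    moreover have "e j \<le> (\<Sum>j\<in>UNIV. e j)" for j by (rule member_le_sum) auto
    ultimately show "e \<in> UNIV \<rightarrow>\<^sub>E {..d}" by (auto intro: order_trans)
  qed
  show "finite ((UNIV :: 'n set) \<rightarrow>\<^sub>E {..d})" by (intro finite_PiE) auto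
qed

lemma poly_cn_deg_le_monomial:
  fixes e0 :: "'n::finite \<Rightarrow> nat"
  assumes "(\<Sum>j\<in>UNIV. e0 j) \<le> d"
  shows "poly_cn_deg_le d (\<lambda>z. k * (\<Prod>j\<in>UNIV. (z $ j) ^ e0 j))"
  unfolding poly_cn_deg_le_def
proof (rule exI[of _ "\<lambda>e. if e = e0 then k else 0"], rule allI)
  fix z :: "complex ^ 'n"
  have "(\<Sum>e\<in>{e. (\<Sum>j\<in>UNIV. e j) \<le> d}. (if e = e0 then k else 0) * (\<Prod>j\<in>UNIV. (z $ j) ^ e j))
     = (\<Sum>e\<in>{e. (\<Sum>j\<in>UNIV. e j) \<le> d}. if e = e0 then k * (\<Prod>j\<in>UNIV. (z $ j) ^ e0 j) else 0)"
    by (rule sum.cong) auto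
  also have "\<dots> = k * (\<Prod>j\<in>UNIV. (z $ j) ^ e0 j)"
    using assms by (subst sum.delta[OF finite_exponents_le]) auto
  finally show "k * (\<Prod>j\<in>UNIV. (z $ j) ^ e0 j) =
      (\<Sum>e\<in>{e. (\<Sum>j\<in>UNIV. e j) \<le> d}. (if e = e0 then k else 0) * (\<Prod>j\<in>UNIV. (z $ j) ^ e j))"
    by simp
qed

lemma poly_cn_deg_le_add:
  assumes "poly_cn_deg_le d g" "poly_cn_deg_le d h"
  shows "poly_cn_deg_le d (\<lambda>z. g z + h z)"
proof -
  obtain co co' where
    "\<forall>z. g z = (\<Sum>e\<in>{e. (\<Sum>j\<in>UNIV. e j) \<le> d}. co e * (\<Prod>j\<in>UNIV. (z $ j) ^ e j))"
    "\<forall>z. h z = (\<Sum>e\<in>{e. (\<Sum>j\<in>UNIV. e j) \<le> d}. co' e * (\<Prod>j\<in>UNIV. (z $ j) ^ e j))"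
    using assms unfolding poly_cn_deg_le_def by blast
  then show ?thesis
    unfolding poly_cn_deg_le_def
    by (intro exI[of _ "\<lambda>e. co e + co' e"]) (simp add: sum.distrib distrib_right)
qed

lemma poly_cn_deg_le_const: "poly_cn_deg_le d (\<lambda>z :: complex ^ 'n::finite. k)"
  using poly_cn_deg_le_monomial[of "\<lambda>_. 0" d k] by simp

lemma poly_cn_deg_le_sum:
  assumes "finite I" "\<And>x. x \<in> I \<Longrightarrow> poly_cn_deg_le d (g x)"
  shows "poly_cn_deg_le d (\<lambda>z :: complex ^ 'n::finite. \<Sum>x\<in>I. g x z)"
  using assms by (induction I rule: finite_induct) (auto intro: poly_cn_deg_le_add poly_cn_deg_le_const)

lemma poly_cn_deg_le_coordinate_product:
  fixes k l :: "'n::finite"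
  shows "poly_cn_deg_le 2 (\<lambda>z. m * (z $ k * z $ l))"
proof -
  \<comment> \<open>Adding the two indicators also covers \<open>k = l\<close>, where the exponent
    is 2.\<close>
  define e0 where "e0 = (\<lambda>j. of_bool (j = k) + of_bool (j = l) :: nat)"
  have "(\<Prod>j\<in>UNIV. (z $ j) ^ e0 j) = z $ k * z $ l" for z :: "complex ^ 'n"
    by (simp add: e0_def power_add prod.distrib of_bool_def if_distrib[of "\<lambda>n. _ ^ n"] prod.delta cong: if_cong)
  moreover have "(\<Sum>j\<in>UNIV. e0 j) \<le> 2"
    by (simp add: e0_def sum.distrib of_bool_def)
  ultimately show ?thesis using poly_cn_deg_le_monomial[of e0 2 m] by simp
qed

lemma poly_cn_deg_le_coordinate:
  fixes k :: "'n::finite"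
  assumes "d \<ge> 1"
  shows "poly_cn_deg_le d (\<lambda>z. m * z $ k)"
proof -
  define e0 where "e0 = (\<lambda>j. of_bool (j = k) :: nat)"
  have "(\<Prod>j\<in>UNIV. (z $ j) ^ e0 j) = z $ k" for z :: "complex ^ 'n"
    by (simp add: e0_def of_bool_def if_distrib[of "\<lambda>n. _ ^ n"] prod.delta cong: if_cong)
  moreover have "(\<Sum>j\<in>UNIV. e0 j) \<le> d"
    using assms by (simp add: e0_def of_bool_def)
  ultimately show ?thesis using poly_cn_deg_le_monomial[of e0 d m] by simp
qed

lemma poly_cn_deg_le_affine_sum:
  assumes "d \<ge> 1"
  shows "poly_cn_deg_le d (\<lambda>z :: complex ^ 'n::finite. k + m * (\<Sum>j\<in>UNIV. z $ j))"
  unfolding sum_distrib_left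
  by (intro poly_cn_deg_le_add poly_cn_deg_le_const poly_cn_deg_le_sum poly_cn_deg_le_coordinate assms) simp

lemma poly_cn_deg_le_square_sum:
  "poly_cn_deg_le 2 (\<lambda>z :: complex ^ 'n::finite. m * (\<Sum>j\<in>UNIV. z $ j)\<^sup>2)"
proof -
  have "m * (\<Sum>j\<in>UNIV. z $ j)\<^sup>2 = (\<Sum>k\<in>UNIV. \<Sum>l\<in>UNIV. m * (z $ k * z $ l))" for z :: "complex ^ 'n"
    by (simp only: power2_eq_square sum_product) (simp only: sum_distrib_left)
  then show ?thesis by (simp add: poly_cn_deg_le_sum poly_cn_deg_le_coordinate_product)
qed

text \<open>On the line \<open>t * v\<close> a monomial of total degree \<open>k\<close> becomes a
  constant times \<open>t ^ k\<close>. This gives lower bounds on the degree from one-variable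
  polynomials.\<close>

lemma poly_cn_deg_le_on_line:
  fixes g :: "complex ^ 'n::finite \<Rightarrow> complex"
  assumes "poly_cn_deg_le d g"
  shows "\<exists>p. degree p \<le> d \<and> (\<forall>t. g (\<chi> j. t * v $ j) = poly p t)"
proof -
  obtain co where co: "\<forall>z. g z = (\<Sum>e\<in>{e. (\<Sum>j\<in>UNIV. e j) \<le> d}. co e * (\<Prod>j\<in>UNIV. (z $ j) ^ e j))"
    using assms unfolding poly_cn_deg_le_def by blast
  define p where "p = (\<Sum>e\<in>{e :: 'n \<Rightarrow> nat. (\<Sum>j\<in>UNIV. e j) \<le> d}.
      monom (co e * (\<Prod>j\<in>UNIV. (v $ j) ^ e j)) (\<Sum>j\<in>UNIV. e j))"
  show ?thesis
  proof (intro exI[of _ p] conjI allI)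
    show "degree p \<le> d"
      unfolding p_def by (rule degree_sum_le[OF finite_exponents_le]) (use degree_monom_le order_trans in blast)
    show "g (\<chi> j. t * v $ j) = poly p t" for t
      unfolding co[rule_format] p_def poly_sum poly_monom
      by (rule sum.cong) (simp_all add: power_mult_distrib prod.distrib power_sum)
  qed
qed

lemma quadratic_deg_eq_2:
  fixes g :: "complex ^ 'n::finite \<Rightarrow> complex"
  assumes a: "a \<noteq> 0" and n: "n \<noteq> 0"
    and g: "\<And>z. n * g z = w0 - a * ((\<Sum>j\<in>UNIV. z $ j) - w0)\<^sup>2"
  shows "poly_cn_deg_eq 2 g"
proof -
  define C where "C = - a / n"
  define B where "B = 2 * a * w0 / n"
  define A where "A = (w0 - a * w0\<^sup>2) / n"
  have geq: "g = (\<lambda>z. (A + B * (\<Sum>j\<in>UNIV. z $ j)) + C * (\<Sum>j\<in>UNIV. z $ j)\<^sup>2)"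
  proof
    fix z :: "complex ^ 'n"
    define s where "s = (\<Sum>j\<in>UNIV. z $ j)"
    have "g z = (w0 - a * (s - w0)\<^sup>2) / n" using g[of z] n unfolding s_def by (metis nonzero_mult_div_cancel_left)
    also have "\<dots> = A + B * s + C * s\<^sup>2"
      unfolding A_def B_def C_def
      by (simp add: add_divide_distrib[symmetric] diff_divide_distrib[symmetric] power2_eq_square algebra_simps)
    finally show "g z = (A + B * (\<Sum>j\<in>UNIV. z $ j)) + C * (\<Sum>j\<in>UNIV. z $ j)\<^sup>2"
      by (simp add: s_def)
  qed
  have "poly_cn_deg_le 2 g"
    unfolding geq by (intro poly_cn_deg_le_add poly_cn_deg_le_affine_sum poly_cn_deg_le_square_sum) simp
  moreover have "\<not> poly_cn_deg_le k g" if k: "k < 2" for k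
  proof
    assume "poly_cn_deg_le k g"
    \<comment> \<open>Along any coordinate axis the sum of the coordinates is \<open>t\<close>;
      \<open>undefined\<close> merely picks some index.\<close>
    then obtain p where p: "degree p \<le> k" "\<forall>t. g (\<chi> j. t * (axis undefined 1 :: complex ^ 'n) $ j) = poly p t"
      using poly_cn_deg_le_on_line by blast
    have "(\<Sum>j\<in>UNIV. (\<chi> j. t * (axis undefined 1 :: complex ^ 'n) $ j) $ j) = t" for t
      by (simp add: axis_def if_distrib[of "\<lambda>x. _ * x"] cong: if_cong)
    then have "poly p t = poly [:A, B, C:] t" for t
      using p(2)[rule_format, of t] unfolding geq by (simp add: algebra_simps power2_eq_square)
    then have "p = [:A, B, C:]" by (simp add: poly_eq_poly_eq_iff[symmetric] fun_eq_iff)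
    then have "degree p = 2" using a n by (simp add: C_def)
    then show False using p(1) k by simp
  qed
  ultimately show ?thesis unfolding poly_cn_deg_eq_def by blast
qed

section \<open>Restriction to a coordinate axis and countable fibres\<close>

lemma entire_cn_continuous:
  assumes "entire_cn g"
  shows "continuous_on A g"
proof -
  have "isCont g z" for z
    using assms has_derivative_continuous unfolding entire_cn_def by blast
  then show ?thesis by (simp add: continuous_at_imp_continuous_on)
qed

lemma bounded_linear_axis: "bounded_linear (axis i :: complex \<Rightarrow> complex ^ 'n::finite)"
  by (rule linear_conv_bounded_linear[THEN iffD1], rule linearI) (simp_all add: vec_eq_iff axis_def)

text \<open>Complex homogeneity of the derivative \<open>L\<close> turns the derivative along the
  axis into multiplication by \<open>L (axis i 1)\<close>.\<close>

lemma entire_cn_on_axis: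
  fixes g :: "complex ^ 'n::finite \<Rightarrow> complex"
  assumes "entire_cn g"
  shows "(\<lambda>s. g (axis i s)) holomorphic_on UNIV"
proof -
  have "(\<lambda>s. g (axis i s)) field_differentiable at s" for s
  proof -
    obtain L where L: "(g has_derivative L) (at (axis i s))" "\<forall>w v. L (\<chi> j. w * v $ j) = w * L v"
      using assms unfolding entire_cn_def by blast
    have "((\<lambda>s. g (axis i s)) has_derivative (\<lambda>h. L (axis i h))) (at s)"
      by (rule has_derivative_compose[OF bounded_linear_imp_has_derivative[OF bounded_linear_axis] L(1)])
    moreover have "(\<lambda>h. L (axis i h)) = (*) (L (axis i 1))"
    proof
      fix h
      have "axis i h = (\<chi> j. h * (axis i 1 :: complex ^ 'n) $ j)" by (simp add: vec_eq_iff axis_def)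
      then show "L (axis i h) = L (axis i 1) * h" using L(2) by simp
    qed
    ultimately have "((\<lambda>s. g (axis i s)) has_field_derivative L (axis i 1)) (at s)"
      unfolding has_field_derivative_def by simp
    then show ?thesis unfolding field_differentiable_def by blast
  qed
  then show ?thesis by (simp add: holomorphic_on_def)
qed

lemma sum_replace_coordinate:
  fixes z :: "complex ^ 'n::finite"
  shows "(\<Sum>j\<in>UNIV. (\<chi> k. if k = i then t else z $ k) $ j) = t + ((\<Sum>j\<in>UNIV. z $ j) - z $ i)"
proof -
  have "(\<Sum>j\<in>UNIV. (\<chi> k. if k = i then t else z $ k) $ j) = (\<Sum>j\<in>UNIV. z $ j + (if j = i then t - z $ i else 0))"
    by (rule sum.cong) auto
  also have "\<dots> = (\<Sum>j\<in>UNIV. z $ j) + (t - z $ i)" by (simp add: sum.distrib)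
  finally show ?thesis by simp
qed

text \<open>The set \<open>P\<close> of singularities is countable and closed, so its complement is
  open and connected, and a non-constant holomorphic function has only countably many zeros there.
  Were \<open>f\<close> constant off \<open>P\<close>, it could have no pole, so \<open>P\<close>
  would be empty and \<open>f\<close> constant.\<close>

lemma nicely_meromorphic_countable_fibre:
  assumes mero: "f nicely_meromorphic_on UNIV" and nonconst: "\<not> (\<exists>k. \<forall>z. f z = k)"
  shows "countable {u. \<not> f analytic_on {u} \<or> f u = k}"
proof -
  define P where "P = {z. \<not> f analytic_on {z}}"
  have mer: "f meromorphic_on UNIV" using mero by (simp add: nicely_meromorphic_on_def)
  have sparse: "P sparse_in UNIV"
    unfolding P_def using mer by (rule meromorphic_on_imp_sparse_singularities)
  have cP: "countable P" using sparse_imp_countable[of UNIV P] sparse by simp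
  have oP: "open (- P)" using sparse_in_UNIV_imp_closed[OF sparse] by (rule open_Compl)
  have "f analytic_on - P" using analytic_on_analytic_at unfolding P_def by blast
  then have holf: "f holomorphic_on - P" by (rule analytic_imp_holomorphic)
  have "\<not> (\<lambda>u. f u - k) constant_on - P"
  proof
    assume "(\<lambda>u. f u - k) constant_on - P"
    then obtain x where x: "\<And>u. u \<notin> P \<Longrightarrow> f u - k = x" unfolding constant_on_def by blast
    have fk: "f u = x + k" if "u \<notin> P" for u using x[OF that] by (simp add: algebra_simps)
    have "P = {}"
    proof (rule ccontr)
      assume "P \<noteq> {}"
      then obtain p where p: "p \<in> P" by blast
      have "is_pole f p" using nicely_meromorphic_on_imp_analytic_at[OF mero, of p] p by (auto simp: P_def)
      then have "filterlim f at_infinity (at p)" by (simp add: is_pole_def)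
      moreover have "eventually (\<lambda>w. w \<notin> P) (at p)"
        using sparse by (simp add: sparse_in_open islimpt_iff_eventually)
      then have "eventually (\<lambda>w. x + k = f w) (at p)" by (rule eventually_mono) (simp add: fk)
      then have "(f \<longlongrightarrow> x + k) (at p)" by (rule Lim_transform_eventually[OF tendsto_const])
      ultimately show False using not_tendsto_and_filterlim_at_infinity trivial_limit_at by blast
    qed
    then show False using fk nonconst by blast
  qed
  moreover have "fsigma (- P)"
    using open_Union_compact_subsets[OF oP] unfolding fsigma_Union_compact
    by (metis (no_types, lifting) image_subset_iff mem_Collect_eq)
  moreover have "connected (- P)"
    using cP by (simp add: path_connected_complement_countable path_connected_imp_connected)
  ultimately have "countable {u \<in> - P. f u - k = 0}"
    using oP by (intro holomorphic_countable_zeros) (auto intro!: holomorphic_intros holf)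
  moreover have "{u. \<not> f analytic_on {u} \<or> f u = k} = P \<union> {u \<in> - P. f u - k = 0}"
    by (auto simp: P_def)
  ultimately show ?thesis using cP by simp
qed

section \<open>Reduction to one variable and conclusion\<close>

theorem theorem1p1:
  fixes f :: "complex \<Rightarrow> complex"
    and g :: "complex ^ 'n \<Rightarrow> complex"
    and i :: 'n
    and a b c :: complex
  assumes f_mero: "f nicely_meromorphic_on UNIV"
    and f_nonconst: "\<not> (\<exists>k. \<forall>z. f z = k)"
    and g_entire: "entire_cn g"
    and a_nz: "a \<noteq> 0"
    and eq: "\<And>z. f analytic_on {\<Sum>j\<in>UNIV. z $ j} \<Longrightarrow>
               f analytic_on {\<Sum>j\<in>UNIV. (\<chi> k::'n. g z) $ j} \<Longrightarrow>
               deriv (\<lambda>t. f (\<Sum>j\<in>UNIV. (\<chi> k. if k = i then t else z $ k) $ j)) (z $ i)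
                 = a * f (\<Sum>j\<in>UNIV. (\<chi> k::'n. g z) $ j) + b * f (\<Sum>j\<in>UNIV. z $ j) + c"
  shows "(transcendental_fun f \<longrightarrow> poly_cn_deg_le 1 g)
       \<and> (rational_fun f \<longrightarrow>
            poly_cn_deg_le 2 g
            \<and> (poly_cn_deg_eq 2 g \<longleftrightarrow>
                 (\<exists>\<alpha> \<beta> w0. \<alpha> \<noteq> 0
                    \<and> (\<forall>z. z \<noteq> w0 \<longrightarrow> f z = \<beta> + \<alpha> / (z - w0))
                    \<and> (\<forall>z. of_nat CARD('n) * g z = w0 - a * ((\<Sum>j\<in>UNIV. z $ j) - w0)\<^sup>2)
                    \<and> b = 0 \<and> a * \<beta> + c = 0)))"
proof -
  define n :: complex where "n = of_nat CARD('n)"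
  have n: "n \<noteq> 0" by (simp add: n_def)
  define S where "S = (\<lambda>z :: complex ^ 'n. \<Sum>j\<in>UNIV. z $ j)"
  have S_axis: "S (axis i s) = s" for s by (simp add: S_def axis_def)
  have S_add: "S (z + z') = S z + S z'" for z z' by (simp add: S_def sum.distrib)
  have S_scale: "S (r *\<^sub>R z) = r *\<^sub>R S z" for r z by (simp add: S_def scaleR_sum_right)
  \<comment> \<open>As a function of the \<open>i\<close>-th coordinate, \<open>h\<close> is a
    translate of \<open>f\<close>, so the partial derivative is \<open>deriv f\<close> at the
    sum.\<close>
  have eq': "deriv f (S z) = a * f (n * g z) + b * f (S z) + c"
    if an: "f analytic_on {S z}" "f analytic_on {n * g z}" for z
  proof -
    have ng: "(\<Sum>j\<in>UNIV. (\<chi> k::'n. g z) $ j) = n * g z" by (simp add: n_def)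
    have "(f has_field_derivative deriv f (S z)) (at (z $ i + (S z - z $ i)))"
      using analytic_on_imp_differentiable_at[OF an(1)] by (simp add: DERIV_deriv_iff_field_differentiable)
    then have "((\<lambda>t. f (t + (S z - z $ i))) has_field_derivative deriv f (S z)) (at (z $ i))"
      by (simp only: DERIV_shift)
    then have "deriv (\<lambda>t. f (t + (S z - z $ i))) (z $ i) = deriv f (S z)" by (rule DERIV_imp_deriv)
    with eq[of z] an show ?thesis unfolding ng sum_replace_coordinate S_def by simp
  qed
  \<comment> \<open>The \<open>i\<close>-th axis meets each hyperplane on which \<open>S\<close> is
    constant in exactly one point, so \<open>\<phi>\<close> reads off the value of
    \<open>n * g\<close> there.\<close>
  define \<phi> where "\<phi> = (\<lambda>s. n * g (axis i s))"
  have hol: "\<phi> holomorphic_on UNIV"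
    unfolding \<phi>_def by (intro holomorphic_intros entire_cn_on_axis g_entire)
  have g_cont: "isCont g z" for z
    using entire_cn_continuous[OF g_entire, of UNIV] by (simp add: continuous_on_eq_continuous_at)
  have regular: "n * g z = \<phi> (S z)" if an: "f analytic_on {S z}" for z
  proof -
    define H where "H = {x. S x = S z}"
    \<comment> \<open>The value that the equation forces on \<open>f (n * g x)\<close> for every
      \<open>x\<close> in \<open>H\<close> at which \<open>f\<close> is analytic at
      \<open>n * g x\<close>.\<close>
    define k where "k = (deriv f (S z) - b * f (S z) - c) / a"
    have "convex H"
      unfolding convex_def H_def by (auto simp: S_add S_scale scaleR_left_distrib[symmetric])
    then have "connected ((\<lambda>x. n * g x) ` H)"
      by (intro connected_continuous_image convex_connected continuous_intros entire_cn_continuous g_entire)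
    moreover have "(\<lambda>x. n * g x) ` H \<subseteq> {u. \<not> f analytic_on {u} \<or> f u = k}"
    proof (rule image_subsetI)
      fix x assume "x \<in> H"
      then have "f analytic_on {n * g x} \<Longrightarrow> f (n * g x) = k"
        using eq'[of x] an a_nz by (simp add: H_def k_def field_simps)
      then show "n * g x \<in> {u. \<not> f analytic_on {u} \<or> f u = k}" by blast
    qed
    then have "countable ((\<lambda>x. n * g x) ` H)"
      using nicely_meromorphic_countable_fibre[OF f_mero f_nonconst] countable_subset by blast
    moreover have "z \<in> H" "axis i (S z) \<in> H" by (simp_all add: H_def S_axis)
    ultimately show ?thesis
      unfolding \<phi>_def using connected_uncountable by blast
  qed
  have factor: "n * g z = \<phi> (S z)" for z
  proof -
    \<comment> \<open>If \<open>S z\<close> is a singularity of \<open>f\<close>, moving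
      \<open>z\<close> along the axis to a nearby sum \<open>w\<close> reaches regular points, where
      \<open>F\<close> vanishes; continuity gives \<open>F (S z) = 0\<close>.\<close>
    define F where "F = (\<lambda>w. n * g (z + axis i (w - S z)) - \<phi> w)"
    have "isCont (\<lambda>w. g (z + axis i (w - S z))) (S z)"
      by (rule isCont_o2[OF _ g_cont]) (intro continuous_intros bounded_linear.isCont[OF bounded_linear_axis])
    moreover have "isCont \<phi> (S z)"
      using holomorphic_on_imp_continuous_on[OF hol] by (simp add: continuous_on_eq_continuous_at)
    ultimately have "isCont F (S z)" unfolding F_def by (intro continuous_intros)
    then have lim: "(F \<longlongrightarrow> F (S z)) (at (S z))" by (simp add: isCont_def)
    have "eventually (\<lambda>w. f analytic_on {w}) (at (S z))"
      using meromorphic_on_imp_sparse_singularities[of f UNIV] f_mero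
      by (simp add: nicely_meromorphic_on_def sparse_in_open islimpt_iff_eventually)
    then have "eventually (\<lambda>w. F w = 0) (at (S z))"
    proof eventually_elim
      case (elim w)
      then show ?case using regular[of "z + axis i (w - S z)"] by (simp add: F_def S_add S_axis)
    qed
    then have "(F \<longlongrightarrow> 0) (at (S z))" using tendsto_eventually by blast
    then have "F (S z) = 0" using lim tendsto_unique[OF trivial_limit_at] by blast
    moreover have "axis i 0 = (0 :: complex ^ 'n)" by (simp add: vec_eq_iff axis_def)
    ultimately show ?thesis by (simp add: F_def)
  qed
  have \<phi>_eq: "deriv f s = a * f (\<phi> s) + b * f s + c" if "f analytic_on {s}" "f analytic_on {\<phi> s}" for s
    using eq'[of "axis i s"] that by (simp add: S_axis \<phi>_def)
  let ?quad = "\<lambda>\<alpha> \<beta> w0. \<alpha> \<noteq> 0 \<and> (\<forall>z. z \<noteq> w0 \<longrightarrow> f z = \<beta> + \<alpha> / (z - w0))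
      \<and> (\<forall>z. of_nat CARD('n) * g z = w0 - a * ((\<Sum>j\<in>UNIV. z $ j) - w0)\<^sup>2) \<and> b = 0 \<and> a * \<beta> + c = 0"
  have quad: "poly_cn_deg_eq 2 g" if "?quad \<alpha> \<beta> w0" for \<alpha> \<beta> w0
    using that n by (intro quadratic_deg_eq_2[OF a_nz n]) (simp add: n_def)
  show ?thesis
  proof (cases "\<exists>A B. \<forall>z. \<phi> z = A * z + B")
    case True
    then obtain A B where AB: "\<And>z. \<phi> z = A * z + B" by blast
    have "g = (\<lambda>z. B / n + A / n * (\<Sum>j\<in>UNIV. z $ j))"
    proof
      fix z :: "complex ^ 'n"
      show "g z = B / n + A / n * (\<Sum>j\<in>UNIV. z $ j)"
        using factor[of z] n by (simp add: AB S_def field_simps)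
    qed
    then have "poly_cn_deg_le d g" if "d \<ge> 1" for d
      using poly_cn_deg_le_affine_sum[OF that] by metis
    then have "poly_cn_deg_le 1 g" "poly_cn_deg_le 2 g" by simp_all
    \<comment> \<open>With \<open>quad\<close>, both sides of the equivalence are false in the
      affine case.\<close>
    moreover from this have "\<not> poly_cn_deg_eq 2 g" unfolding poly_cn_deg_eq_def by force
    ultimately show ?thesis using quad by blast
  next
    case False
    obtain \<alpha> \<beta> w0 where sol: "\<alpha> \<noteq> 0" "\<forall>z. z \<noteq> w0 \<longrightarrow> f z = \<beta> + \<alpha> / (z - w0)"
        "\<forall>z. \<phi> z = w0 - a * (z - w0)\<^sup>2" "b = 0" "a * \<beta> + c = 0"
      using functional_equation_solution[OF f_mero f_nonconst hol False a_nz \<phi>_eq] by blast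
    have "?quad \<alpha> \<beta> w0" using sol factor by (simp add: n_def S_def)
    moreover from this have "poly_cn_deg_eq 2 g" by (rule quad)
    moreover from this have "poly_cn_deg_le 2 g" unfolding poly_cn_deg_eq_def by blast
    moreover have "rational_fun f"
      \<comment> \<open>The quotient of \<open>\<alpha> - \<beta> * w0 + \<beta> * z\<close> by
        \<open>z - w0\<close>.\<close>
      unfolding rational_fun_def
      by (rule exI[of _ "[:\<alpha> - \<beta> * w0, \<beta>:]"], rule exI[of _ "[:- w0, 1:]"])
        (use sol(2) in \<open>auto simp: field_simps\<close>)
    ultimately show ?thesis unfolding transcendental_fun_def by blast
  qed
qed

end
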